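(* Let $n\ge2$, let $X_1,\dots,X_n$ be Banach spaces and $D_k\in\mathcal{B}(X_k)$, and assume that $D_s-\lambda$ satisfies the complements condition for all $2\le s\le n-1$ and all $\lambda\in\mathbb{C}$. Then for every $A\in\mathcal{B}_n$, $$\bigcup_{k=1}^n\sigma_{e}(D_k)=\sigma_{e}(T_n^d(A))\cup\Delta,\qquad \Delta=(\Delta_1\cup\Delta_2)\cap\rho_{le}(D_1)\cap\rho_{re}(D_n),$$ where $\Delta_1$ is the set of $\lambda\in\mathbb{C}$ for which there is $k\in\{2,\dots,n-1\}$ such that either (a) $\alpha(D_k-\lambda)=\sum_{s=1}^{k-1}\beta(D_s-\lambda)=\infty$ and $\alpha(D_s-\lambda)<\infty$ for $2\le s\le k-1$, or (b) $\beta(D_k-\lambda)=\sum_{s=k+1}^{n}\alpha(D_s-\lambda)=\infty$ and $\beta(D_s-\lambda)<\infty$ for $k+1\le s\le n-1$; and $\Delta_2$ is the set of $\lambda\in\mathbb{C}$ such that either (c) $\alpha(D_n-\lambda)=\sum_{s=1}^{n-1}\beta(D_s-\lambda)=\infty$ and $\alpha(D_s-\lambda)<\infty$ for $2\le s\le n-1$, or (d) $\beta(D_1-\lambda)=\sum_{s=2}^{n}\alpha(D_s-\lambda)=\infty$ and $\beta(D_s-\lambda)<\infty$ for $2\le s\le n-1$.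
   Context: For a bounded operator $T$ between Banach spaces, $\alpha(T)=\dim\mathcal{N}(T)$, $\beta(T)=\operatorname{codim}\mathcal{R}(T)$, values in $\{0,1,\dots\}\cup\{\infty\}$, sums taken in this extended set. $T\in\mathcal{B}(X,Y)$ satisfies the complements condition if $\mathcal{N}(T)$ is topologically complemented in $X$ and $\overline{\mathcal{R}(T)}$ is topologically complemented in $Y$. $T$ is left Fredholm if $\alpha(T)<\infty$ and $\mathcal{R}(T)$ is closed and complemented; right Fredholm if $\beta(T)<\infty$ and $\mathcal{N}(T)$ is complemented; Fredholm if $\alpha(T)<\infty$ and $\beta(T)<\infty$. $\sigma_{le},\sigma_{re},\sigma_e$ denote the sets of $\lambda\in\mathbb{C}$ with $\lambda-T$ not left Fredholm, not right Fredholm, not Fredholm respectively; $\rho_{le},\rho_{re}$ their complements. $\mathcal{B}_n$ is the set of tuples $A=(A_{ij})_{1\le i<j\le n}$, $A_{ij}\in\mathcal{B}(X_j,X_i)$; $T_n^d(A)$ is the upper triangular operator matrix on $X_1\oplus\cdots\oplus X_n$ with diagonal $D_1,\dots,D_n$, entries $A_{ij}$ above the diagonal and zeros below. *)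

theory Defs
  imports "HOL-Analysis.Analysis" "HOL-Library.Extended_Nat" "HOL-Library.Function_Algebras"
begin

class scaleC_op =
  fixes scaleC :: "complex \<Rightarrow> 'a \<Rightarrow> 'a" (infixr "*\<^sub>C" 75)

class complex_vector = real_vector + scaleC_op +
  assumes scaleC_add_right: "a *\<^sub>C (x + y) = a *\<^sub>C x + a *\<^sub>C y"
    and scaleC_add_left: "(a + b) *\<^sub>C x = a *\<^sub>C x + b *\<^sub>C x"
    and scaleC_scaleC: "a *\<^sub>C (b *\<^sub>C x) = (a * b) *\<^sub>C x"
    and scaleC_one: "1 *\<^sub>C x = x"
    and scaleR_scaleC: "r *\<^sub>R x = complex_of_real r *\<^sub>C x"

class complex_normed_vector = complex_vector + real_normed_vector +
  assumes norm_scaleC: "norm (a *\<^sub>C x) = cmod a * norm x"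

class complex_banach = complex_normed_vector + complete_space

definition lin_span :: "(complex \<Rightarrow> 'b \<Rightarrow> 'b) \<Rightarrow> 'b::comm_monoid_add set \<Rightarrow> 'b set" where
  "lin_span sc S = {(\<Sum>x\<in>F. sc (c x) x) | F c. finite F \<and> F \<subseteq> S}"

definition gdim :: "(complex \<Rightarrow> 'b \<Rightarrow> 'b) \<Rightarrow> 'b::comm_monoid_add set \<Rightarrow> enat" where
  "gdim sc V = (INF S \<in> {S. finite S \<and> S \<subseteq> V \<and> V \<subseteq> lin_span sc S}. enat (card S))"

definition gcodim :: "(complex \<Rightarrow> 'b \<Rightarrow> 'b) \<Rightarrow> 'b::comm_monoid_add set \<Rightarrow> 'b set \<Rightarrow> enat" where
  "gcodim sc R V = (INF S \<in> {S. finite S \<and> S \<subseteq> V \<and> V \<subseteq> lin_span sc (R \<union> S)}. enat (card S))"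

definition galpha :: "(complex \<Rightarrow> 'b \<Rightarrow> 'b) \<Rightarrow> 'b::comm_monoid_add set \<Rightarrow> ('b \<Rightarrow> 'b) \<Rightarrow> enat"
  where "galpha sc X T = gdim sc {x \<in> X. T x = 0}"

definition gbeta :: "(complex \<Rightarrow> 'b \<Rightarrow> 'b) \<Rightarrow> 'b set \<Rightarrow> 'b set \<Rightarrow> ('b \<Rightarrow> 'b::comm_monoid_add) \<Rightarrow> enat"
  where "gbeta sc X Y T = gcodim sc (T ` X) Y"

text \<open>Banach spaces X_1,...,X_n are represented as closed complex subspaces of one ambient
  complex Banach space (any finite family of Banach spaces embeds isometrically this way,
  e.g. into its direct sum).\<close>
definition csubspace :: "'a::complex_vector set \<Rightarrow> bool" where
  "csubspace X \<longleftrightarrow> 0 \<in> X \<and> (\<forall>x\<in>X. \<forall>y\<in>X. x + y \<in> X) \<and> (\<forall>c. \<forall>x\<in>X. c *\<^sub>C x \<in> X)"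

definition banach_subspace :: "'a::complex_banach set \<Rightarrow> bool" where
  "banach_subspace X \<longleftrightarrow> csubspace X \<and> closed X"

definition bounded_op :: "'a::complex_normed_vector set \<Rightarrow> 'a set \<Rightarrow> ('a \<Rightarrow> 'a) \<Rightarrow> bool" where
  "bounded_op X Y T \<longleftrightarrow> (\<forall>x\<in>X. T x \<in> Y)
     \<and> (\<forall>x\<in>X. \<forall>y\<in>X. T (x + y) = T x + T y)
     \<and> (\<forall>c. \<forall>x\<in>X. T (c *\<^sub>C x) = c *\<^sub>C T x)
     \<and> (\<exists>K. \<forall>x\<in>X. norm (T x) \<le> K * norm x)"

abbreviation alpha :: "'a::complex_vector set \<Rightarrow> ('a \<Rightarrow> 'a) \<Rightarrow> enat" where
  "alpha X T \<equiv> galpha scaleC X T"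

abbreviation beta :: "'a::complex_vector set \<Rightarrow> ('a \<Rightarrow> 'a) \<Rightarrow> enat" where
  "beta X T \<equiv> gbeta scaleC X X T"

definition top_complemented :: "'a::complex_normed_vector set \<Rightarrow> 'a set \<Rightarrow> bool" where
  "top_complemented M X \<longleftrightarrow> csubspace M \<and> closed M \<and> M \<subseteq> X \<and>
     (\<exists>W. csubspace W \<and> closed W \<and> W \<subseteq> X \<and> M \<inter> W = {0} \<and>
          X = {m + w | m w. m \<in> M \<and> w \<in> W})"

definition complements_condition :: "'a::complex_normed_vector set \<Rightarrow> ('a \<Rightarrow> 'a) \<Rightarrow> bool" where
  "complements_condition X T \<longleftrightarrow>
     top_complemented {x \<in> X. T x = 0} X \<and> top_complemented (closure (T ` X)) X"

definition left_fredholm :: "'a::complex_normed_vector set \<Rightarrow> ('a \<Rightarrow> 'a) \<Rightarrow> bool" where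
  "left_fredholm X T \<longleftrightarrow> alpha X T < \<infinity> \<and> closed (T ` X) \<and> top_complemented (T ` X) X"

definition right_fredholm :: "'a::complex_normed_vector set \<Rightarrow> ('a \<Rightarrow> 'a) \<Rightarrow> bool" where
  "right_fredholm X T \<longleftrightarrow> beta X T < \<infinity> \<and> top_complemented {x \<in> X. T x = 0} X"

definition fredholm :: "'a::complex_normed_vector set \<Rightarrow> ('a \<Rightarrow> 'a) \<Rightarrow> bool" where
  "fredholm X T \<longleftrightarrow> alpha X T < \<infinity> \<and> beta X T < \<infinity>"

definition shift :: "('a::complex_vector \<Rightarrow> 'a) \<Rightarrow> complex \<Rightarrow> 'a \<Rightarrow> 'a" where
  "shift T z = (\<lambda>x. T x - z *\<^sub>C x)"

definition ess_spec :: "'a::complex_normed_vector set \<Rightarrow> ('a \<Rightarrow> 'a) \<Rightarrow> complex set" where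
  "ess_spec X T = {z. \<not> fredholm X (shift T z)}"

definition rho_le :: "'a::complex_normed_vector set \<Rightarrow> ('a \<Rightarrow> 'a) \<Rightarrow> complex set" where
  "rho_le X T = {z. left_fredholm X (shift T z)}"

definition rho_re :: "'a::complex_normed_vector set \<Rightarrow> ('a \<Rightarrow> 'a) \<Rightarrow> complex set" where
  "rho_re X T = {z. right_fredholm X (shift T z)}"

definition dsum :: "nat \<Rightarrow> (nat \<Rightarrow> 'a::complex_vector set) \<Rightarrow> (nat \<Rightarrow> 'a) set" where
  "dsum n X = {x. (\<forall>k\<in>{1..n}. x k \<in> X k) \<and> (\<forall>k. k \<notin> {1..n} \<longrightarrow> x k = 0)}"

definition scaleC_fun :: "complex \<Rightarrow> (nat \<Rightarrow> 'a::complex_vector) \<Rightarrow> nat \<Rightarrow> 'a" where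
  "scaleC_fun c x = (\<lambda>k. c *\<^sub>C x k)"

definition tri_matrix :: "nat \<Rightarrow> (nat \<Rightarrow> 'a \<Rightarrow> 'a) \<Rightarrow> (nat \<Rightarrow> nat \<Rightarrow> 'a \<Rightarrow> 'a)
    \<Rightarrow> (nat \<Rightarrow> 'a::complex_vector) \<Rightarrow> nat \<Rightarrow> 'a" where
  "tri_matrix n D A x = (\<lambda>i. if i \<in> {1..n} then D i (x i) + (\<Sum>j\<in>{i<..n}. A i j (x j)) else 0)"

definition ess_spec_sum :: "nat \<Rightarrow> (nat \<Rightarrow> 'a::complex_vector set) \<Rightarrow> ((nat \<Rightarrow> 'a) \<Rightarrow> nat \<Rightarrow> 'a) \<Rightarrow> complex set" where
  "ess_spec_sum n X T = {z. \<not> (galpha scaleC_fun (dsum n X) (\<lambda>x. T x - scaleC_fun z x) < \<infinity>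
        \<and> gbeta scaleC_fun (dsum n X) (dsum n X) (\<lambda>x. T x - scaleC_fun z x) < \<infinity>)}"

end

(* For fixed z the statement is about T_k = D_k - z and the triangular operator F_n built from them.
   Compressing F_(k+1) to its first k coordinates gives F_k, with quotient T_(k+1), so the snake lemma
   relates finiteness of the kernels and cokernels of F_k, F_(k+1), T_(k+1). If F_n is Fredholm but
   some T_k is not, this forces some T_k to have an infinite-dimensional kernel; for the least such k
   some T_s with s < k must have infinite codimension of its range, which is case (a) or (c).
   That T_1 is left Fredholm and T_n right Fredholm is the analytic part: R(T_1) has
   {F y | y_1 = 0, F y in X_1} as a complement up to finite dimension, and N(T_n) has
   {y_n | F y in X_n}. These are ranges of bounded operators on Banach spaces, so the open mapping
   theorem makes them closed, and Hahn-Banach functionals remove the finite-dimensional overlap. *)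
theory Submission
  imports Defs
begin

section \<open>Finite codimension\<close>

text \<open>Every condition in the theorem asks only whether some \<open>alpha\<close> or
  \<open>beta\<close> is infinite, so the algebra works with finiteness alone and never with the
  numbers. The obstacle on the analytic side is that R(T_1) may have infinite codimension although
  F_n is Fredholm; an algebraic complement then says nothing about closedness. It becomes useful
  because two operator ranges in direct sum control each other: the sum map from the product of
  their domains is onto, so small vectors have small preimages, and uniqueness of the decomposition
  keeps a limit of vectors of one range from acquiring a component in the other. The overlap of the
  two ranges comes from N(F_n), and their sum has finite codimension because R(F_n) does. The X_k
  are subsets of one type and operators are arbitrary off them, so linearity and bounds are stated
  on sets throughout; the direct sum, a bare set of functions, has to be placed in a Banach space
  type before such arguments apply to it.\<close>

definition lin_on :: "('k \<Rightarrow> 'b \<Rightarrow> 'b) \<Rightarrow> ('k \<Rightarrow> 'c \<Rightarrow> 'c) \<Rightarrow> 'b::plus set \<Rightarrow> ('b \<Rightarrow> 'c::plus) \<Rightarrow> bool" where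
  "lin_on s1 s2 V f \<longleftrightarrow> (\<forall>x\<in>V. \<forall>y\<in>V. f (x + y) = f x + f y) \<and> (\<forall>c. \<forall>x\<in>V. f (s1 c x) = s2 c (f x))"

lemma lin_onD:
  assumes "lin_on s1 s2 V f"
  shows "x \<in> V \<Longrightarrow> y \<in> V \<Longrightarrow> f (x + y) = f x + f y" "x \<in> V \<Longrightarrow> f (s1 c x) = s2 c (f x)"
  using assms by (auto simp: lin_on_def)

lemma lin_on_subset: "lin_on s1 s2 V f \<Longrightarrow> W \<subseteq> V \<Longrightarrow> lin_on s1 s2 W f"
  unfolding lin_on_def by blast

lemma lin_on_id: "lin_on s s V (\<lambda>x. x)"
  by (simp add: lin_on_def)

text \<open>The finite set S need not lie in V; for subspaces R of V this makes no difference
  (cofin_strong), so this is finite codimension there, and finite dimension of V if R is empty.\<close>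

definition cofin :: "('k::field \<Rightarrow> 'b \<Rightarrow> 'b) \<Rightarrow> 'b::ab_group_add set \<Rightarrow> 'b set \<Rightarrow> bool" where
  "cofin s R V \<longleftrightarrow> (\<exists>S. finite S \<and> V \<subseteq> module.span s (R \<union> S))"

context vector_space
begin

lemma cofin_mono: "cofin scale R V \<Longrightarrow> R \<subseteq> R' \<Longrightarrow> V' \<subseteq> V \<Longrightarrow> cofin scale R' V'"
  unfolding cofin_def by (meson Un_mono order_refl order_trans span_mono)

lemma cofin_trans: assumes "cofin scale R V" "cofin scale V W" shows "cofin scale R W"
proof -
  obtain S S' where S: "finite S" "V \<subseteq> span (R \<union> S)" "finite S'" "W \<subseteq> span (V \<union> S')"
    using assms unfolding cofin_def by blast
  have "span (V \<union> S') \<subseteq> span (R \<union> (S \<union> S'))"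
    by (intro span_minimal subspace_span Un_least order_trans[OF S(2)] span_mono)
      (auto intro: span_base)
  then show ?thesis unfolding cofin_def using S by (meson finite_Un order_trans)
qed

lemma cofin_span: "cofin scale R V \<Longrightarrow> cofin scale R (span (R \<union> V))"
  unfolding cofin_def
  by (metis Un_least Un_upper1 order_trans span_superset span_minimal subspace_span)

lemma cofin_span_superset: "V \<subseteq> span R \<Longrightarrow> cofin scale R V"
  unfolding cofin_def by (intro exI[of _ "{}"]) simp

lemma lin_on_zero:
  assumes "lin_on scale s2 V f" "subspace V" "vector_space s2" shows "f 0 = 0"
proof -
  interpret w: vector_space s2 by fact
  have "f (scale 0 0) = s2 0 (f 0)" using assms subspace_0 by (metis lin_onD(2))
  then show ?thesis by simp
qed

lemma lin_on_diff:
  assumes "lin_on scale s2 V f" "subspace V" "vector_space s2" "x \<in> V" "y \<in> V"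
  shows "f (x - y) = f x - f y"
proof -
  have "x - y \<in> V" using assms subspace_diff by blast
  then have "f ((x - y) + y) = f (x - y) + f y" using assms by (simp only: lin_onD(1))
  then show ?thesis by simp
qed

lemma subspace_preimage:
  assumes "lin_on scale s2 V f" "subspace V" "vector_space s2" "module.subspace s2 W"
  shows "subspace {x\<in>V. f x \<in> W}"
proof -
  interpret w: vector_space s2 by fact
  show ?thesis
    unfolding subspace_def using assms lin_on_zero[OF assms(1-3)]
    by (auto simp: lin_onD[OF assms(1)] w.subspace_0 w.subspace_add w.subspace_scale
        subspace_0 subspace_add subspace_scale)
qed

lemma subspace_image:
  assumes "lin_on scale s2 V f" "subspace V" "vector_space s2"
  shows "module.subspace s2 (f ` V)"
proof -
  interpret w: vector_space s2 by fact
  show ?thesis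
    unfolding w.subspace_def
  proof (intro conjI ballI allI)
    show "0 \<in> f ` V" using lin_on_zero[OF assms] subspace_0[OF assms(2)] by force
  next
    fix x y assume "x \<in> f ` V" "y \<in> f ` V"
    then obtain a b where "x = f a" "y = f b" "a \<in> V" "b \<in> V" by blast
    then show "x + y \<in> f ` V"
      using lin_onD(1)[OF assms(1), of a b] subspace_add[OF assms(2), of a b] by (intro image_eqI[of _ _ "a + b"]) auto
  next
    fix c x assume "x \<in> f ` V"
    then obtain a where "x = f a" "a \<in> V" by blast
    then show "s2 c x \<in> f ` V"
      using lin_onD(2)[OF assms(1), of a c] subspace_scale[OF assms(2), of a c]
      by (intro image_eqI[of _ _ "scale c a"]) auto
  qed
qed

lemma image_span_subset:
  assumes "lin_on scale s2 V f" "subspace V" "vector_space s2" "Z \<subseteq> V"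
  shows "f ` span Z \<subseteq> module.span s2 (f ` Z)"
proof -
  interpret w: vector_space s2 by fact
  have "span Z \<subseteq> {x\<in>V. f x \<in> w.span (f ` Z)}"
    by (rule span_minimal) (use assms subspace_preimage[OF assms(1-3)] in \<open>auto intro: w.span_base\<close>)
  then show ?thesis by blast
qed

text \<open>Induction on \<open>S\<close>: allowing one more generator \<open>a\<close> in the
  target enlarges the preimage by at most one dimension, so one further vector of \<open>V\<close>
  suffices. That \<open>S'\<close> lies in \<open>V\<close> is what later turns arbitrary generators
  into generators from \<open>V\<close>.\<close>

lemma cofin_preimage_strong:
  assumes f: "lin_on scale s2 V f" and V: "subspace V" and v2: "vector_space s2"
    and "module.subspace s2 R" "finite S" "f ` V \<subseteq> module.span s2 (R \<union> S)"
  shows "\<exists>S'. finite S' \<and> S' \<subseteq> V \<and> V \<subseteq> span ({v\<in>V. f v \<in> R} \<union> S')"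
  using assms(5,4,6)
proof (induction S arbitrary: R rule: finite_induct)
  interpret w: vector_space s2 by fact
  case empty
  then have "f ` V \<subseteq> R" by (metis w.span_eq_iff sup_bot_right)
  then have "V \<subseteq> {v\<in>V. f v \<in> R} \<union> {}" by blast
  then have "V \<subseteq> span ({v\<in>V. f v \<in> R} \<union> {})" by (rule order_trans) (rule span_superset)
  then show ?case by blast
next
  interpret w: vector_space s2 by fact
  case (insert a S)
  define R1 where "R1 = w.span (insert a R)"
  have "R \<union> insert a S \<subseteq> R1 \<union> S" unfolding R1_def using w.span_superset[of "insert a R"] by blast
  then have "f ` V \<subseteq> w.span (R1 \<union> S)"
    by (rule order_trans[OF insert.prems(2) w.span_mono])
  then obtain S' where S': "finite S'" "S' \<subseteq> V" "V \<subseteq> span ({v\<in>V. f v \<in> R1} \<union> S')"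
    using insert.IH[of R1] w.subspace_span[of "insert a R"] unfolding R1_def by blast
  let ?P = "{v\<in>V. f v \<in> R}"
  have R1: "y \<in> R1 \<longleftrightarrow> (\<exists>k. y - s2 k a \<in> R)" for y
    unfolding R1_def w.span_insert w.span_eq_iff[THEN iffD2, OF insert.prems(1)] by simp
  \<comment> \<open>If some \<open>v0\<close> maps to a nonzero multiple of \<open>a\<close> modulo
    \<open>R\<close>, it spans the preimage of \<open>R1\<close> over that of \<open>R\<close>; if
    none does, the two preimages coincide.\<close>
  have "\<exists>v0\<in>V. {v\<in>V. f v \<in> R1} \<subseteq> span (?P \<union> {v0})"
  proof (cases "\<exists>v0\<in>V. \<exists>k. k \<noteq> 0 \<and> f v0 - s2 k a \<in> R")
    case True
    then obtain v0 k0 where v0: "v0 \<in> V" "k0 \<noteq> 0" "f v0 - s2 k0 a \<in> R" by (elim bexE exE conjE)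
    have "v \<in> span (?P \<union> {v0})" if "v \<in> V" "f v \<in> R1" for v
    proof -
      obtain k where k: "f v - s2 k a \<in> R" using R1[of "f v"] \<open>f v \<in> R1\<close> by blast
      let ?u = "v - scale (k / k0) v0"
      have kv: "scale (k / k0) v0 \<in> V" using V v0 subspace_scale by blast
      have "f ?u = f v - s2 (k / k0) (f v0)"
        using lin_on_diff[OF f V v2 that(1) kv] lin_onD(2)[OF f v0(1)] by simp
      also have "\<dots> = (f v - s2 k a) - s2 (k / k0) (f v0 - s2 k0 a)"
        using v0(2) by (simp add: w.scale_right_diff_distrib)
      also have "\<dots> \<in> R"
        by (rule w.subspace_diff[OF insert.prems(1) k w.subspace_scale[OF insert.prems(1) v0(3)]])
      finally have "?u \<in> ?P" using kv that V subspace_diff[of V v] by simp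
      then have "?u \<in> span (?P \<union> {v0})" by (simp add: span_base)
      moreover have "scale (k / k0) v0 \<in> span (?P \<union> {v0})" by (simp add: span_base span_scale)
      ultimately have "?u + scale (k / k0) v0 \<in> span (?P \<union> {v0})" by (rule span_add)
      then show ?thesis by simp
    qed
    then show ?thesis using v0(1) by blast
  next
    case False
    have "f v \<in> R" if "v \<in> V" "f v \<in> R1" for v
    proof -
      obtain k where k: "f v - s2 k a \<in> R" using R1[of "f v"] \<open>f v \<in> R1\<close> by blast
      then have "k = 0" using False that by blast
      then show ?thesis using k by simp
    qed
    then have "{v\<in>V. f v \<in> R1} \<subseteq> span (?P \<union> {0})" by (auto intro: span_base)
    then show ?thesis using V subspace_0 by blast
  qed
  then obtain v0 where v0: "v0 \<in> V" "{v\<in>V. f v \<in> R1} \<subseteq> span (?P \<union> {v0})" by blast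
  have "span ({v\<in>V. f v \<in> R1} \<union> S') \<subseteq> span (?P \<union> insert v0 S')"
  proof (intro span_minimal subspace_span Un_least)
    show "{v\<in>V. f v \<in> R1} \<subseteq> span (?P \<union> insert v0 S')"
      by (rule order_trans[OF v0(2)], rule span_mono) auto
    show "S' \<subseteq> span (?P \<union> insert v0 S')" by (auto intro: span_base)
  qed
  then show ?case using S' v0(1) by (intro exI[of _ "insert v0 S'"]) auto
qed

lemma cofin_preimage:
  assumes "lin_on scale s2 V f" "subspace V" "vector_space s2" "module.subspace s2 R"
    and "cofin s2 R (f ` V)"
  shows "cofin scale {v\<in>V. f v \<in> R} V"
proof -
  obtain S where "finite S" "f ` V \<subseteq> module.span s2 (R \<union> S)" using assms(5) unfolding cofin_def by blast
  then show ?thesis using cofin_preimage_strong[OF assms(1-4)] unfolding cofin_def by blast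
qed

text \<open>The preimage lemma for the identity map replaces generators outside \<open>V\<close> by
  generators inside, as the definition of \<open>gcodim\<close> demands.\<close>

lemma cofin_strong:
  assumes "subspace V" "subspace R" "R \<subseteq> V" "cofin scale R V"
  shows "\<exists>S. finite S \<and> S \<subseteq> V \<and> V \<subseteq> span (R \<union> S)"
proof -
  obtain S where "finite S" "V \<subseteq> span (R \<union> S)" using assms unfolding cofin_def by blast
  moreover have "{v\<in>V. v \<in> R} = R" using assms by blast
  ultimately show ?thesis
    using cofin_preimage_strong[OF lin_on_id[of scale V] assms(1) vector_space_axioms assms(2), of S]
    by simp
qed

text \<open>Linearity of \<open>f\<close> is known on \<open>V\<close> only, so the generators have
  to be moved into \<open>V\<close> before \<open>f\<close> is applied to them.\<close>

lemma cofin_image: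
  assumes f: "lin_on scale s2 V f" "subspace V" "vector_space s2"
    and R: "subspace R" "R \<subseteq> V" "cofin scale R V"
  shows "cofin s2 (f ` R) (f ` V)"
proof -
  obtain S where S: "finite S" "S \<subseteq> V" "V \<subseteq> span (R \<union> S)" using cofin_strong[OF f(2) R] by blast
  then have "f ` V \<subseteq> module.span s2 (f ` (R \<union> S))"
    using image_span_subset[OF f, of "R \<union> S"] R by blast
  then show ?thesis unfolding cofin_def image_Un using S by blast
qed

text \<open>Rank-nullity: the kernel is the preimage of zero, and zero has finite codimension in a
  finite-dimensional range.\<close>

lemma fin_kernel_range:
  assumes f: "lin_on scale s2 V f" "subspace V" "vector_space s2"
    and "cofin s2 {} (f ` V)" "cofin scale {} {v\<in>V. f v = 0}"
  shows "cofin scale {} V"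
proof -
  interpret w: vector_space s2 by fact
  have "cofin s2 {0} (f ` V)" using w.cofin_mono[OF assms(4)] by simp
  then have "cofin scale {v\<in>V. f v \<in> {0}} V"
    by (rule cofin_preimage[OF f w.subspace_single_0])
  then show ?thesis using cofin_trans[OF assms(5)] by simp
qed

lemma fin_image:
  assumes f: "lin_on scale s2 V f" "subspace V" "vector_space s2" "cofin scale {} V"
  shows "cofin s2 {} (f ` V)"
proof -
  interpret w: vector_space s2 by fact
  \<comment> \<open>\<open>{0}\<close> stands in for the empty set because
    \<open>cofin_image\<close> asks for a subspace.\<close>
  have "cofin s2 (f ` {0}) (f ` V)"
    using cofin_image[OF f(1-3) subspace_single_0] cofin_mono[OF f(4), of "{0}" V] subspace_0[OF f(2)] by simp
  moreover have "cofin s2 {} (f ` {0})" unfolding cofin_def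
    by (metis Un_empty_left finite.emptyI finite_imageI finite_insert w.span_superset)
  ultimately show ?thesis by (metis w.cofin_trans)
qed

end

section \<open>Translation of \<open>gdim\<close> and \<open>gcodim\<close> into finiteness\<close>

lemma lin_span_eq_span:
  assumes "vector_space s" shows "lin_span s S = module.span s S"
proof -
  interpret vector_space s by fact
  show ?thesis unfolding lin_span_def span_explicit by blast
qed

text \<open>Each \<open>card S\<close> is finite, so the infimum in \<open>enat\<close> is infinite
  only over the empty set: finiteness means that an admissible \<open>S\<close> exists, and
  \<open>cofin_strong\<close> supplies one inside \<open>V\<close>.\<close>

lemma gcodim_finite_iff:
  assumes "vector_space s" "module.subspace s V" "module.subspace s R" "R \<subseteq> V"
  shows "gcodim s R V < \<infinity> \<longleftrightarrow> cofin s R V"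
proof -
  interpret vector_space s by fact
  have "gcodim s R V < \<infinity> \<longleftrightarrow> (\<exists>S. finite S \<and> S \<subseteq> V \<and> V \<subseteq> span (R \<union> S))"
    unfolding gcodim_def lin_span_eq_span[OF assms(1)] by (simp only: INF_less_iff) auto
  also have "\<dots> \<longleftrightarrow> cofin s R V"
    using cofin_strong[OF assms(2-4)] unfolding cofin_def by blast
  finally show ?thesis .
qed

text \<open>Dimension is codimension of the zero space; adding 0 to a generating set does not change
  its span.\<close>

lemma gdim_finite_iff:
  assumes "vector_space s" "module.subspace s V"
  shows "gdim s V < \<infinity> \<longleftrightarrow> cofin s {} V"
proof -
  interpret vector_space s by fact
  have 1: "{0} \<subseteq> V" using assms subspace_0 by blast
  have *: "span ({0} \<union> S) = span S" for S by (simp add: span_insert_0)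
  have "gdim s V = gcodim s {0} V"
    unfolding gdim_def gcodim_def lin_span_eq_span[OF assms(1)] * ..
  moreover have "cofin s {0} V \<longleftrightarrow> cofin s {} V" unfolding cofin_def * by simp
  ultimately show ?thesis
    using gcodim_finite_iff[OF assms(1,2) subspace_single_0 1] by simp
qed

definition fin_alpha :: "('k::field \<Rightarrow> 'b \<Rightarrow> 'b) \<Rightarrow> 'b::ab_group_add set \<Rightarrow> ('b \<Rightarrow> 'b) \<Rightarrow> bool" where
  "fin_alpha s X T \<longleftrightarrow> cofin s {} {x\<in>X. T x = 0}"

definition fin_beta :: "('k::field \<Rightarrow> 'b \<Rightarrow> 'b) \<Rightarrow> 'b::ab_group_add set \<Rightarrow> ('b \<Rightarrow> 'b) \<Rightarrow> bool" where
  "fin_beta s X T \<longleftrightarrow> cofin s (T ` X) X"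

lemma
  assumes "vector_space s" "module.subspace s X" "lin_on s s X T"
  shows galpha_finite_iff: "galpha s X T < \<infinity> \<longleftrightarrow> fin_alpha s X T"
    and gbeta_finite_iff: "T ` X \<subseteq> X \<Longrightarrow> gbeta s X X T < \<infinity> \<longleftrightarrow> fin_beta s X T"
proof -
  interpret vector_space s by fact
  have "subspace {x\<in>X. T x = 0}"
    using subspace_preimage[OF assms(3,2,1) subspace_single_0] by simp
  then show "galpha s X T < \<infinity> \<longleftrightarrow> fin_alpha s X T"
    unfolding galpha_def fin_alpha_def using gdim_finite_iff assms(1) by blast
  show "gbeta s X X T < \<infinity> \<longleftrightarrow> fin_beta s X T" if "T ` X \<subseteq> X"
    unfolding gbeta_def fin_beta_def
    using gcodim_finite_iff[OF assms(1,2) subspace_image[OF assms(3,2,1)] that] .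
qed

section \<open>Finiteness in the snake lemma\<close>

text \<open>T leaves the kernel G of p invariant and induces T' on the quotient H / G = K.\<close>

locale operator_extension = v: vector_space s + w: vector_space s'
  for s :: "'k::field \<Rightarrow> 'b \<Rightarrow> 'b::ab_group_add" and s' :: "'k \<Rightarrow> 'c \<Rightarrow> 'c::ab_group_add" +
  fixes H K T T' p
  assumes H: "v.subspace H" and K: "w.subspace K"
    and T: "lin_on s s H T" "T ` H \<subseteq> H" and T': "lin_on s' s' K T'" "T' ` K \<subseteq> K"
    and p: "lin_on s s' H p" "p ` H = K" and pT: "h \<in> H \<Longrightarrow> p (T h) = T' (p h)"
begin

abbreviation "G \<equiv> {h\<in>H. p h = 0}"

lemma subspace_G: "v.subspace G"
  using v.subspace_preimage[OF p(1) H w.vector_space_axioms w.subspace_single_0] by simp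

lemma T_G: "T ` G \<subseteq> G"
proof clarify
  fix h assume "h \<in> H" "p h = 0"
  then show "T h \<in> H \<and> p (T h) = 0"
    using T(2) pT[of h] w.lin_on_zero[OF T'(1) K w.vector_space_axioms] by auto
qed

text \<open>\<open>p\<close> sends the range of \<open>T\<close> into that of \<open>T'\<close>, so
  the cokernel of \<open>T\<close> maps onto the cokernel of \<open>T'\<close>.\<close>

lemma quotient_beta: assumes "fin_beta s H T" shows "fin_beta s' K T'"
proof -
  have "cofin s' (p ` T ` H) (p ` H)"
    using v.cofin_image[OF p(1) H w.vector_space_axioms v.subspace_image[OF T(1) H v.vector_space_axioms] T(2)]
      assms unfolding fin_beta_def .
  moreover have "p ` T ` H \<subseteq> T' ` K" using p(2) pT by force
  ultimately show ?thesis unfolding fin_beta_def p(2) by (rule w.cofin_mono) simp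
qed

text \<open>Right exactness of cokernels: if \<open>p h\<close> lies in the range of
  \<open>T'\<close>, then \<open>h\<close> differs from a vector in the range of \<open>T\<close> by
  one of \<open>G\<close>.\<close>

lemma extension_beta:
  assumes "fin_beta s G T" "fin_beta s' K T'" shows "fin_beta s H T"
proof -
  have "cofin s {h\<in>H. p h \<in> T' ` K} H"
    using v.cofin_preimage[OF p(1) H w.vector_space_axioms w.subspace_image[OF T'(1) K w.vector_space_axioms]]
      p(2) assms(2) unfolding fin_beta_def by simp
  moreover have "cofin s (T ` H) (v.span (T ` H \<union> G))"
    by (intro v.cofin_span v.cofin_mono[OF assms(1)[unfolded fin_beta_def]]) auto
  moreover have "{h\<in>H. p h \<in> T' ` K} \<subseteq> v.span (T ` H \<union> G)"
  proof
    fix h assume "h \<in> {h\<in>H. p h \<in> T' ` K}"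
    then obtain g where g: "h \<in> H" "g \<in> H" "p h = p (T g)" using p pT by force
    have "T g \<in> H" using g T by blast
    then have "h - T g \<in> G"
      using g v.lin_on_diff[OF p(1) H w.vector_space_axioms] v.subspace_diff[OF H] by simp
    then have "T g + (h - T g) \<in> v.span (T ` H \<union> G)"
      using g by (intro v.span_add) (auto intro: v.span_base)
    then show "h \<in> v.span (T ` H \<union> G)" by simp
  qed
  ultimately show ?thesis
    unfolding fin_beta_def using v.cofin_mono v.cofin_trans by blast
qed

text \<open>Left exactness of kernels: \<open>p\<close> maps the kernel of \<open>T\<close> into
  that of \<open>T'\<close>, and what it kills there is the kernel of \<open>T\<close> on
  \<open>G\<close>.\<close>

lemma extension_alpha:
  assumes "fin_alpha s G T" "fin_alpha s' K T'" shows "fin_alpha s H T"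
  unfolding fin_alpha_def
proof (rule v.fin_kernel_range)
  let ?N = "{h\<in>H. T h = 0}"
  show "lin_on s s' ?N p" by (rule lin_on_subset[OF p(1)]) auto
  show "v.subspace ?N"
    using v.subspace_preimage[OF T(1) H v.vector_space_axioms v.subspace_single_0] by simp
  have "p ` ?N \<subseteq> {x\<in>K. T' x = 0}"
  proof clarify
    fix h assume "h \<in> H" "T h = 0"
    then show "p h \<in> K \<and> T' (p h) = 0"
      using p(2) pT[of h] v.lin_on_zero[OF p(1) H w.vector_space_axioms] by auto
  qed
  then show "cofin s' {} (p ` ?N)" by (rule w.cofin_mono[OF assms(2)[unfolded fin_alpha_def] order_refl])
  show "cofin s {} {v\<in>?N. p v = 0}"
    by (rule v.cofin_mono[OF assms(1)[unfolded fin_alpha_def]]) auto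
qed (rule w.vector_space_axioms)

text \<open>Connecting map of the snake lemma: a vector in the kernel of \<open>T'\<close> lifts to
  some \<open>h\<close> in \<open>?Z\<close>, and the class of \<open>T h\<close> modulo the range
  of \<open>T\<close> on \<open>G\<close> lies in a finite-dimensional space. The vectors of
  \<open>?Q\<close>, where this class vanishes, agree modulo \<open>G\<close> with vectors in the
  kernel of \<open>T\<close>, so \<open>p\<close> maps them into the image of a finite-dimensional
  space.\<close>

lemma quotient_alpha:
  assumes "fin_alpha s H T" "fin_beta s G T" shows "fin_alpha s' K T'"
proof -
  let ?Z = "{h\<in>H. T h \<in> G}" and ?Q = "{h\<in>H. T h \<in> T ` G}"
  note TG = lin_on_subset[OF T(1), of G, simplified]
  have sTG: "v.subspace (T ` G)" using v.subspace_image[OF TG subspace_G v.vector_space_axioms] by simp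
  have sZ: "v.subspace ?Z" using v.subspace_preimage[OF T(1) H v.vector_space_axioms subspace_G] .
  have sQ: "v.subspace ?Q" using v.subspace_preimage[OF T(1) H v.vector_space_axioms sTG] .
  have lZ: "lin_on s s ?Z T" by (rule lin_on_subset[OF T(1)]) auto
  have lp: "lin_on s s' ?Z p" by (rule lin_on_subset[OF p(1)]) auto
  have "cofin s (T ` G) (T ` ?Z)"
    by (rule v.cofin_mono[OF assms(2)[unfolded fin_beta_def]]) auto
  from v.cofin_preimage[OF lZ sZ v.vector_space_axioms sTG this]
  have "cofin s ?Q ?Z" by (rule v.cofin_mono) auto
  moreover have "?Q \<subseteq> ?Z" using T_G by auto
  ultimately have c: "cofin s' (p ` ?Q) (p ` ?Z)"
    by (intro v.cofin_image[OF lp sZ w.vector_space_axioms sQ])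
  let ?N = "{h\<in>H. T h = 0}"
  have sN: "v.subspace ?N" using v.subspace_preimage[OF T(1) H v.vector_space_axioms v.subspace_single_0] by simp
  have lN: "lin_on s s' ?N p" by (rule lin_on_subset[OF p(1)]) auto
  have "cofin s' {} (p ` ?N)"
    using v.fin_image[OF lN sN w.vector_space_axioms] assms(1) unfolding fin_alpha_def .
  moreover have "p ` ?Q \<subseteq> p ` ?N"
  proof clarify
    fix h g assume h: "h \<in> H" "T h = T g" "g \<in> H" "p g = 0"
    have "p (h - g) = p h" "T (h - g) = 0" "h - g \<in> H"
      using h v.lin_on_diff[OF p(1) H w.vector_space_axioms h(1,3)]
        v.lin_on_diff[OF T(1) H v.vector_space_axioms h(1,3)] v.subspace_diff[OF H] by auto
    then show "p h \<in> p ` ?N" by (metis (mono_tags, lifting) image_eqI mem_Collect_eq)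
  qed
  ultimately have "cofin s' {} (p ` ?Z)"
    by (intro w.cofin_trans[OF _ c]) (rule w.cofin_mono, auto)
  moreover have "{x\<in>K. T' x = 0} \<subseteq> p ` ?Z" using p(2) pT T(2) by force
  ultimately show ?thesis unfolding fin_alpha_def by (rule w.cofin_mono[OF _ order_refl])
qed

text \<open>The other end of the connecting map: \<open>T\<close> maps the preimage
  \<open>?Z\<close> of the kernel of \<open>T'\<close> onto the part of the range of
  \<open>T\<close> inside \<open>G\<close>. That part has finite codimension in \<open>G\<close>, as
  the whole range has in \<open>H\<close>; the range of \<open>T\<close> on \<open>G\<close> has
  finite codimension in it, as \<open>?Z\<close> exceeds \<open>G\<close> by finitely many
  dimensions.\<close>

lemma sub_beta:
  assumes "fin_beta s H T" "fin_alpha s' K T'" shows "fin_beta s G T"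
proof -
  let ?Z = "{h\<in>H. T' (p h) = 0}" and ?N = "{x\<in>K. T' x = 0}"
  have sN: "w.subspace ?N" using w.subspace_preimage[OF T'(1) K w.vector_space_axioms w.subspace_single_0] by simp
  have "?Z = {h\<in>H. p h \<in> ?N}" using p(2) by blast
  then have sZ: "v.subspace ?Z" using v.subspace_preimage[OF p(1) H w.vector_space_axioms sN] by simp
  have lp: "lin_on s s' ?Z p" by (rule lin_on_subset[OF p(1)]) auto
  have lT: "lin_on s s ?Z T" by (rule lin_on_subset[OF T(1)]) auto
  have GZ: "G \<subseteq> ?Z" using w.lin_on_zero[OF T'(1) K w.vector_space_axioms] by auto
  have "cofin s' {0} (p ` ?Z)"
    by (rule w.cofin_mono[OF assms(2)[unfolded fin_alpha_def]]) (use p(2) in auto)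
  from v.cofin_preimage[OF lp sZ w.vector_space_axioms w.subspace_single_0 this]
  have "cofin s G ?Z" by (rule v.cofin_mono) auto
  then have 1: "cofin s (T ` G) (T ` ?Z)"
    by (rule v.cofin_image[OF lT sZ v.vector_space_axioms subspace_G GZ])
  have sTH: "v.subspace (T ` H)" using v.subspace_image[OF T(1) H v.vector_space_axioms] .
  have "cofin s (T ` H) ((\<lambda>x. x) ` G)"
    by (rule v.cofin_mono[OF assms(1)[unfolded fin_beta_def]]) auto
  from v.cofin_preimage[OF lin_on_id subspace_G v.vector_space_axioms sTH this]
  have "cofin s (T ` ?Z) G" by (rule v.cofin_mono) (auto simp: pT)
  with 1 show ?thesis unfolding fin_beta_def by (rule v.cofin_trans)
qed

end

section \<open>Open mapping and Hahn-Banach theorems\<close>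

lemma subspace_lin_image:
  assumes "lin_on scaleR scaleR S f" "subspace S" shows "subspace (f ` S)"
  using real_vector.subspace_image[OF assms real_vector.vector_space_axioms]
  by (simp add: subspace_raw_def)


text \<open>Baire category in the range with its own topology: the closures of the images of balls
  of integer radius cover it, so one of them contains a relatively open ball. Because closures are
  involved, only approximate preimages result.\<close>

lemma open_mapping_approx:
  fixes f :: "'b::banach \<Rightarrow> 'c::banach"
  assumes S: "subspace S" and f: "lin_on scaleR scaleR S f" and V: "closed (f ` S)"
  obtains C where "C > 0"
    "\<And>y d. y \<in> f ` S \<Longrightarrow> d > 0 \<Longrightarrow> \<exists>x\<in>S. norm x \<le> C * norm y \<and> norm (y - f x) < d"
proof -
  note add = lin_onD(1)[OF f] and scale = lin_onD(2)[OF f]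
  define V where "V = f ` S"
  define B where "B m = V \<inter> closure (f ` (S \<inter> cball 0 (real m)))" for m
  have f0: "f 0 = 0" using scale[of 0 0] S by (simp add: subspace_0)
  have V0: "0 \<in> V" unfolding V_def using f0 S by (metis image_eqI subspace_0)
  have "V \<subseteq> \<Union>(range B)"
  proof
    fix y assume "y \<in> V"
    then obtain x where x: "x \<in> S" "y = f x" unfolding V_def by blast
    then have "x \<in> S \<inter> cball 0 (real (nat \<lceil>norm x\<rceil>))" by (simp add: real_nat_ceiling_ge)
    then have "y \<in> closure (f ` (S \<inter> cball 0 (real (nat \<lceil>norm x\<rceil>))))"
      unfolding x(2) by (intro subsetD[OF closure_subset] imageI)
    then have "y \<in> B (nat \<lceil>norm x\<rceil>)" unfolding B_def using \<open>y \<in> V\<close> by simp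
    then show "y \<in> \<Union>(range B)" by blast
  qed
  moreover have "\<Union>(range B) \<subseteq> V" unfolding B_def by blast
  ultimately have U: "\<Union>(range B) = V" by blast
  have cm: "completely_metrizable_space (top_of_set V)"
    using V completely_metrizable_space_closedin[OF completely_metrizable_space_euclidean, of V]
    unfolding V_def by simp
  have "\<exists>m. top_of_set V interior_of B m \<noteq> {}"
  proof (rule ccontr)
    assume "\<not> ?thesis"
    then have "top_of_set V interior_of \<Union>(range B) = {}"
      using cm by (intro Baire_category_alt) (auto simp: B_def intro!: closedin_closed_Int)
    moreover have "top_of_set V interior_of V = V"
      using interior_of_topspace[of "top_of_set V"] by simp
    ultimately show False using U V0 by simp
  qed
  then obtain m y0 where "y0 \<in> top_of_set V interior_of B m" by blast
  then obtain W where W: "open W" "y0 \<in> W" "V \<inter> W \<subseteq> B m" "y0 \<in> V"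
    unfolding interior_of_def openin_open by blast
  then obtain e where e: "e > 0" "cball y0 e \<subseteq> W" using open_contains_cball by blast
  have near: "\<exists>x\<in>S. norm x \<le> m \<and> norm (y - f x) < d" if p: "y \<in> V" "norm (y - y0) \<le> e" "d > 0" for y d
  proof -
    have "y \<in> closure (f ` (S \<inter> cball 0 (real m)))"
      using W(3) e(2) p unfolding B_def by (auto simp: dist_norm norm_minus_commute)
    then obtain z where "z \<in> f ` (S \<inter> cball 0 (real m))" "dist z y < d"
      using closure_approachable p(3) by blast
    then show ?thesis by (auto simp: dist_norm norm_minus_commute)
  qed
  have Vsub: "subspace V" unfolding V_def
    using subspace_lin_image[OF f S] .
  \<comment> \<open>Approximate preimages of \<open>y0 + y\<close> and of \<open>y0\<close> are
    subtracted, which recentres the ball at zero, doubles the radius \<open>m\<close> and adds the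
    two errors \<open>d / 2\<close>.\<close>
  have small: "\<exists>x\<in>S. norm x \<le> 2 * m \<and> norm (y - f x) < d" if p: "y \<in> V" "norm y \<le> e" "d > 0" for y d
  proof -
    have "y0 + y \<in> V" using Vsub W(4) p(1) by (simp add: subspace_add)
    then obtain a where a: "a \<in> S" "norm a \<le> m" "norm (y0 + y - f a) < d / 2"
      using near[of "y0 + y" "d / 2"] p by auto
    obtain b where b: "b \<in> S" "norm b \<le> m" "norm (y0 - f b) < d / 2"
      using near[of y0 "d / 2"] p W(4) e(1) by auto
    have "f (a - b) = f a - f b"
      by (rule real_vector.lin_on_diff[OF f S real_vector.vector_space_axioms a(1) b(1)])
    then have eq: "y - f (a - b) = (y0 + y - f a) - (y0 - f b)" by simp
    have "norm (y - f (a - b)) < d"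
      unfolding eq using norm_triangle_ineq4[of "y0 + y - f a" "y0 - f b"] a(3) b(3) by linarith
    moreover have "norm (a - b) \<le> 2 * m" using norm_triangle_ineq4[of a b] a b by simp
    ultimately show ?thesis using a b S subspace_diff by blast
  qed
  \<comment> \<open>A vector \<open>y\<close> will be rescaled to norm \<open>e\<close>, whence the
    division by \<open>e\<close>; the added 1 keeps the constant positive if \<open>m\<close> is
    0.\<close>
  let ?C = "(2 * m + 1) / e"
  have "\<exists>x\<in>S. norm x \<le> ?C * norm y \<and> norm (y - f x) < d" if y: "y \<in> f ` S" "d > 0" for y d
  proof (cases "y = 0")
    case True
    then show ?thesis using S f0 y by (intro bexI[of _ 0]) (auto simp: subspace_0)
  next
    case False
    define k where "k = e / norm y"
    have k: "k > 0" using e False by (simp add: k_def)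
    have "k *\<^sub>R y \<in> V" "norm (k *\<^sub>R y) \<le> e"
      using Vsub y e(1) False by (auto simp: V_def[symmetric] subspace_scale k_def)
    then obtain x where x: "x \<in> S" "norm x \<le> 2 * m" "norm (k *\<^sub>R y - f x) < k * d"
      using small[of "k *\<^sub>R y" "k * d"] k y(2) by auto
    let ?x = "(1 / k) *\<^sub>R x"
    have eq: "y - f ?x = (1 / k) *\<^sub>R (k *\<^sub>R y - f x)"
      using k scale[OF x(1), of "1 / k"] by (simp add: scaleR_diff_right)
    have "norm (y - f ?x) < d" unfolding eq using x(3) k by (simp add: pos_divide_less_eq mult.commute)
    moreover have "norm ?x = norm x * norm y / e" using k e False by (simp add: k_def)
    moreover have "norm x * norm y / e \<le> ?C * norm y"
      using x(2) e(1) by (simp add: divide_right_mono mult_right_mono)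
    ultimately show ?thesis using x(1) S by (intro bexI[of _ ?x]) (auto simp: subspace_scale)
  qed
  moreover have "?C > 0" using e by simp
  ultimately show thesis using that by blast
qed

text \<open>Iterated correction: the residual of each approximate solution is solved again with half
  the tolerance, and the corrections sum to an exact preimage. Their norms decay like powers of 1/2,
  so the constant of the approximate version doubles.\<close>

theorem open_mapping_bound:
  fixes f :: "'b::banach \<Rightarrow> 'c::banach"
  assumes S: "subspace S" "closed S" and f: "lin_on scaleR scaleR S f"
    and K: "\<And>x. x \<in> S \<Longrightarrow> norm (f x) \<le> K * norm x" and V: "closed (f ` S)"
  obtains C where "C > 0" "\<And>y. y \<in> f ` S \<Longrightarrow> \<exists>x\<in>S. f x = y \<and> norm x \<le> C * norm y"
proof -
  obtain C where C: "C > 0"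
    "\<And>y d. y \<in> f ` S \<Longrightarrow> d > 0 \<Longrightarrow> \<exists>x\<in>S. norm x \<le> C * norm y \<and> norm (y - f x) < d"
    using open_mapping_approx[OF S(1) f V] by blast
  then obtain g where g: "g y d \<in> S" "norm (g y d) \<le> C * norm y" "norm (y - f (g y d)) < d"
    if "y \<in> f ` S" "d > 0" for y d by metis
  note diff = real_vector.lin_on_diff[OF f S(1) real_vector.vector_space_axioms]
  have Vsub: "subspace (f ` S)"
    using subspace_lin_image[OF f S(1)] .
  have f0: "f 0 = 0" using real_vector.lin_on_zero[OF f S(1) real_vector.vector_space_axioms] .
  have "\<exists>x\<in>S. f x = y \<and> norm x \<le> (2 * C) * norm y" if y: "y \<in> f ` S" for y
  proof (cases "y = 0")
    case True
    then show ?thesis using S f0 by (intro bexI[of _ 0]) (auto simp: subspace_0)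
  next
    case False
    \<comment> \<open>The exponent \<open>Suc n\<close> makes the residual after \<open>n\<close>
      steps at most \<open>norm y * (1/2) ^ n\<close>, which for \<open>n = 0\<close> is the norm of
      \<open>y\<close> itself.\<close>
    define d where "d n = norm y * (1/2) ^ Suc n" for n
    have d: "d n > 0" for n using False by (simp add: d_def)
    define R where "R = rec_nat y (\<lambda>n r. r - f (g r (d n)))"
    define x where "x n = g (R n) (d n)" for n
    have R0: "R 0 = y" and RS: "R (Suc n) = R n - f (x n)" for n by (simp_all add: R_def x_def)
    have RV: "R n \<in> f ` S" for n
    proof (induction n)
      case (Suc n)
      then show ?case unfolding RS x_def using g(1)[OF Suc d] Vsub by (simp add: subspace_diff)
    qed (simp add: R0 y)
    have xS: "x n \<in> S" for n unfolding x_def using g(1)[OF RV d] .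
    have Rn: "norm (R n) \<le> norm y * (1/2) ^ n" for n
    proof (cases n)
      case (Suc k)
      then show ?thesis using g(3)[OF RV d, of k k] by (simp add: RS x_def d_def)
    qed (simp add: R0)
    have xn: "norm (x n) \<le> C * norm y * (1/2) ^ n" for n
      using order_trans[OF g(2)[OF RV d] mult_left_mono[OF Rn[of n], of C]] C(1) unfolding x_def
      by (simp add: mult.assoc)
    have sg: "summable (\<lambda>n. C * norm y * (1/2) ^ n)" by (intro summable_mult) (simp add: summable_geometric)
    have sx: "summable x" by (rule summable_comparison_test'[OF sg xn])
    have ps: "sum x {..<n} \<in> S" for n using xS S(1) by (intro subspace_sum) auto
    have fps: "f (sum x {..<n}) = y - R n" for n
    proof (induction n)
      case (Suc n)
      then show ?case using lin_onD(1)[OF f ps[of n] xS[of n]] by (simp add: RS)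
    qed (simp add: R0 f0)
    have lim: "(\<lambda>n. sum x {..<n}) \<longlonglongrightarrow> suminf x" using sx by (rule summable_LIMSEQ)
    have sS: "suminf x \<in> S" using S(2) ps lim by (metis closed_sequentially)
    \<comment> \<open>\<open>f\<close> is controlled on \<open>S\<close> only, so its continuity is
      read off from the bound for the difference of two elements of \<open>S\<close>.\<close>
    have "(\<lambda>n. f (sum x {..<n}) - f (suminf x)) \<longlonglongrightarrow> 0"
    proof (rule Lim_null_comparison)
      show "\<forall>\<^sub>F n in sequentially. norm (f (sum x {..<n}) - f (suminf x)) \<le> K * norm (sum x {..<n} - suminf x)"
        using K ps sS diff S(1) by (metis (no_types, lifting) eventuallyI subspace_diff)
      show "(\<lambda>n. K * norm (sum x {..<n} - suminf x)) \<longlonglongrightarrow> 0"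
        using lim by (intro tendsto_mult_right_zero tendsto_norm_zero) (simp add: LIM_zero)
    qed
    then have 1: "(\<lambda>n. f (sum x {..<n})) \<longlonglongrightarrow> f (suminf x)" by (simp add: LIM_zero_iff)
    have "(\<lambda>n. norm y * (1/2) ^ n) \<longlonglongrightarrow> 0"
      by (intro tendsto_mult_right_zero) (simp add: LIMSEQ_power_zero)
    then have "R \<longlonglongrightarrow> 0" using Rn by (intro Lim_null_comparison[of R]) auto
    then have "(\<lambda>n. f (sum x {..<n})) \<longlonglongrightarrow> y - 0" unfolding fps by (intro tendsto_diff) auto
    then have "f (suminf x) = y" using 1 LIMSEQ_unique by fastforce
    moreover have "norm (suminf x) \<le> (\<Sum>n. C * norm y * (1/2) ^ n)"
      by (rule norm_suminf_le[OF xn sg])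
    moreover have "(\<Sum>n. C * norm y * (1/2) ^ n) = C * norm y * 2"
      by (subst suminf_mult) (simp_all add: summable_geometric suminf_geometric)
    ultimately show ?thesis using sS by (intro bexI[of _ "suminf x"]) auto
  qed
  then show thesis using that[of "2 * C"] C(1) by auto
qed

text \<open>Zorn's lemma on graphs: a partial functional dominated by the norm is a subspace of
  pairs \<open>(x, t)\<close> with \<open>t \<le> norm x\<close>, so extension is inclusion and a
  chain is bounded by its union. Starting from the line through \<open>(r, norm r)\<close> fixes the
  value at \<open>r\<close>.\<close>

theorem hahn_banach_norm:
  fixes r :: "'b::real_normed_vector"
  obtains g where "linear g" "\<And>x. \<bar>g x\<bar> \<le> norm x" "g r = norm r"
proof -
  define A where "A = {G::('b \<times> real) set. subspace G \<and> (r, norm r) \<in> G \<and> (\<forall>x t. (x, t) \<in> G \<longrightarrow> t \<le> norm x)}"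
  have "span {(r, norm r)} \<in> A"
  proof -
    have "t \<le> norm x" if xt: "(x, t) \<in> span {(r, norm r)}" for x t
    proof -
      obtain k where "(x, t) = k *\<^sub>R (r, norm r)" using xt by (auto simp: span_singleton)
      then show ?thesis by (simp add: mult_right_mono)
    qed
    then show ?thesis unfolding A_def by (auto simp: span_base)
  qed
  moreover have "\<Union>\<C> \<in> A" if C: "\<C> \<noteq> {}" "subset.chain A \<C>" for \<C>
  proof -
    have CA: "\<C> \<subseteq> A" using C by (simp add: subset.chain_def)
    have "subspace (\<Union>\<C>)"
      unfolding subspace_def
    proof (intro conjI ballI allI)
      show "0 \<in> \<Union>\<C>" using C(1) CA subspace_0 unfolding A_def by blast
    next
      fix x y assume "x \<in> \<Union>\<C>" "y \<in> \<Union>\<C>"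
      then obtain G H where GH: "G \<in> \<C>" "H \<in> \<C>" "x \<in> G" "y \<in> H" by blast
      then have "G \<subseteq> H \<or> H \<subseteq> G" using C(2) by (simp add: subset_chain_def)
      then obtain L where "L \<in> \<C>" "x \<in> L" "y \<in> L" using GH by blast
      then show "x + y \<in> \<Union>\<C>" using CA subspace_add unfolding A_def by blast
    next
      fix c x assume "x \<in> \<Union>\<C>"
      then show "c *\<^sub>R x \<in> \<Union>\<C>" using CA subspace_scale unfolding A_def by blast
    qed
    then show ?thesis using CA C(1) unfolding A_def by blast
  qed
  ultimately obtain G where G: "G \<in> A" and max: "\<And>H. H \<in> A \<Longrightarrow> G \<subseteq> H \<Longrightarrow> H = G"
    using subset_Zorn_nonempty[of A] by blast
  have sG: "subspace G" and rG: "(r, norm r) \<in> G" and nG: "\<And>x t. (x, t) \<in> G \<Longrightarrow> t \<le> norm x"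
    using G unfolding A_def by auto
  \<comment> \<open>Domination makes the graph single-valued: with \<open>(0, t)\<close> it contains
    \<open>(0, -t)\<close>, and both second entries are at most 0.\<close>
  have uniq: "s = t" if "(x, s) \<in> G" "(x, t) \<in> G" for x s t
    using nG[of 0 "s - t"] nG[of 0 "t - s"] subspace_diff[OF sG that] subspace_diff[OF sG that(2,1)] by simp
  have total: "\<exists>t. (x, t) \<in> G" for x
  proof -
    \<comment> \<open>Every lower bound for the value at a new vector \<open>x\<close> lies under
      every upper bound, which leaves room for a value \<open>c\<close>.\<close>
    have sep: "s - norm (y - x) \<le> norm (z + x) - t" if "(y, s) \<in> G" "(z, t) \<in> G" for y s z t
    proof -
      have "s + t \<le> norm (y + z)" using nG[of "y + z" "s + t"] subspace_add[OF sG that] by simp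
      also have "\<dots> \<le> norm (y - x) + norm (z + x)" using norm_triangle_ineq[of "y - x" "z + x"] by simp
      finally show ?thesis by simp
    qed
    have 0: "(0, 0) \<in> G" using subspace_0[OF sG] by (simp add: zero_prod_def)
    define Q where "Q = (\<lambda>(y, s). s - norm (y - x)) ` G"
    define c where "c = Sup Q"
    have "bdd_above Q" unfolding Q_def using sep[OF _ 0] by (intro bdd_aboveI2[of _ _ "norm x"]) auto
    then have c1: "s - norm (y - x) \<le> c" if "(y, s) \<in> G" for y s
      unfolding c_def using that by (intro cSup_upper) (auto simp: Q_def)
    have c2: "c \<le> norm (z + x) - t" if "(z, t) \<in> G" for z t
      unfolding c_def using sep[OF _ that] 0 by (intro cSup_least) (auto simp: Q_def)
    define H where "H = span (insert (x, c) G)"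
    have H: "p \<in> H \<longleftrightarrow> (\<exists>k. p - k *\<^sub>R (x, c) \<in> G)" for p
      unfolding H_def span_insert using sG by (simp add: span_eq_iff[THEN iffD2])
    have "t \<le> norm w" if wt: "(w, t) \<in> H" for w t
    proof -
      obtain k where k: "(w - k *\<^sub>R x, t - k * c) \<in> G" using wt H by auto
      have sc: "((1 / a) *\<^sub>R (w - k *\<^sub>R x), (t - k * c) / a) \<in> G" for a
        using subspace_scale[OF sG k, of "1 / a"] by simp
      \<comment> \<open>After division by the absolute value of \<open>k\<close>, the upper bound
        \<open>c2\<close> settles positive \<open>k\<close> and the lower bound \<open>c1\<close>
        negative \<open>k\<close>.\<close>
      consider "k = 0" | "k > 0" | "k < 0" by linarith
      then show ?thesis
      proof cases
        case 1
        then show ?thesis using k nG by simp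
      next
        case 2
        have "(1 / k) *\<^sub>R (w - k *\<^sub>R x) + x = (1 / k) *\<^sub>R w" using 2 by (simp add: scaleR_diff_right)
        then show ?thesis using c2[OF sc[of k]] 2 by (simp add: field_simps)
      next
        case 3
        have "(1 / - k) *\<^sub>R (w - k *\<^sub>R x) - x = (1 / - k) *\<^sub>R w" using 3 by (simp add: scaleR_diff_right)
        then have "(t - k * c) / - k - norm w / - k \<le> c" using c1[OF sc[of "- k"]] 3 by simp
        then have "- k * ((t - k * c) / - k - norm w / - k) \<le> - k * c" using 3 by (intro mult_left_mono) auto
        then show ?thesis using 3 by (simp add: field_simps)
      qed
    qed
    moreover have "G \<subseteq> H" "(x, c) \<in> H" "subspace H" unfolding H_def by (auto intro: span_base)
    ultimately have "H \<in> A" using rG unfolding A_def by blast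
    then show ?thesis using max \<open>G \<subseteq> H\<close> \<open>(x, c) \<in> H\<close> by blast
  qed
  define g where "g x = (SOME t. (x, t) \<in> G)" for x
  have g: "(x, g x) \<in> G" for x unfolding g_def using total by (rule someI_ex)
  have gI: "g x = t" if "(x, t) \<in> G" for x t using uniq[OF g that] .
  have "g (x + y) = g x + g y" for x y using subspace_add[OF sG g[of x] g[of y]] by (intro gI) simp
  moreover have gs: "g (k *\<^sub>R x) = k *\<^sub>R g x" for k x
    using subspace_scale[OF sG g[of x], of k] by (intro gI) simp
  ultimately have "linear g" by (rule linearI)
  moreover have "\<bar>g x\<bar> \<le> norm x" for x
    using nG[OF g[of x]] nG[OF g[of "- x"]] gs[of "-1" x] by simp
  ultimately show thesis using that gI[OF rG] by blast
qed

section \<open>Ranges of bounded operators that are complementary up to finite dimension\<close>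

interpretation cv: vector_space "scaleC :: complex \<Rightarrow> 'a \<Rightarrow> 'a::complex_vector"
  by unfold_locales (simp_all add: scaleC_add_right scaleC_add_left scaleC_scaleC scaleC_one)

lemma csubspace_iff: "csubspace X \<longleftrightarrow> cv.subspace X"
  by (auto simp: csubspace_def cv.subspace_def)

lemma csubspace_imp_subspace: "cv.subspace X \<Longrightarrow> subspace X"
  unfolding cv.subspace_def subspace_def by (simp add: scaleR_scaleC)

instance complex_banach \<subseteq> banach ..

lemma hahn_banach_functional:
  fixes r :: "'a::complex_normed_vector"
  assumes "r \<noteq> 0"
  obtains \<phi> :: "'a \<Rightarrow> complex" and K where "\<And>x y. \<phi> (x + y) = \<phi> x + \<phi> y"
    "\<And>c x. \<phi> (c *\<^sub>C x) = c * \<phi> x" "\<And>x. cmod (\<phi> x) \<le> K * norm x" "\<phi> r = 1"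
proof -
  obtain g where g: "linear g" "\<And>x. \<bar>g x\<bar> \<le> norm x" "g r = norm r"
    using hahn_banach_norm[of r] by blast
  note [simp] = linear_add[OF g(1)] linear_diff[OF g(1)] linear_scale[OF g(1)]
  \<comment> \<open>The complex-linear functional with real part \<open>g\<close>: compatibility
    with multiplication by the imaginary unit dictates the imaginary part.\<close>
  define \<psi> where "\<psi> x = Complex (g x) (- g (\<i> *\<^sub>C x))" for x
  have add: "\<psi> (x + y) = \<psi> x + \<psi> y" for x y
    by (simp add: \<psi>_def scaleC_add_right complex_eq_iff)
  have scale: "\<psi> (c *\<^sub>C x) = c * \<psi> x" for c x
  proof -
    have c: "c = complex_of_real (Re c) + complex_of_real (Im c) * \<i>"
      by (simp add: complex_eq_iff)
    have 1: "c *\<^sub>C x = Re c *\<^sub>R x + Im c *\<^sub>R (\<i> *\<^sub>C x)"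
      by (subst c) (simp only: scaleC_add_left scaleR_scaleC scaleC_scaleC)
    have "\<i> * c = complex_of_real (Re c) * \<i> + complex_of_real (- Im c)"
      by (simp add: complex_eq_iff)
    then have 2: "\<i> *\<^sub>C (c *\<^sub>C x) = Re c *\<^sub>R (\<i> *\<^sub>C x) + (- Im c) *\<^sub>R x"
      by (simp only: scaleC_add_left scaleR_scaleC scaleC_scaleC)
    show ?thesis unfolding \<psi>_def 1 2[unfolded 1]
      by (simp add: complex_eq_iff flip: scaleR_minus_left)
  qed
  have bound: "cmod (\<psi> x) \<le> 2 * norm x" for x
    using cmod_le[of "\<psi> x"] g(2)[of x] g(2)[of "\<i> *\<^sub>C x"] by (simp add: \<psi>_def norm_scaleC)
  have r: "\<psi> r \<noteq> 0" using g(3) assms by (simp add: \<psi>_def complex_eq_iff)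
  show thesis
  proof (rule that)
    \<comment> \<open>Division by \<open>\<psi> r\<close> normalises the value at \<open>r\<close>
      to 1; the 2 comes from adding the bounds for the real and the imaginary part.\<close>
    show "cmod (\<psi> x / \<psi> r) \<le> (2 / cmod (\<psi> r)) * norm x" for x
      using bound[of x] by (simp add: norm_divide divide_right_mono)
  qed (use r in \<open>simp_all add: add scale add_divide_distrib\<close>)
qed

text \<open>The distance \<open>d\<close> from \<open>x\<close> to \<open>S\<close> bounds
  coefficients, since \<open>cmod k * d \<le> norm (s + k *\<^sub>C x)\<close>. In a convergent
  sequence the coefficients of \<open>x\<close> are therefore Cauchy, and the parts in the closed
  set \<open>S\<close> converge as well.\<close>

lemma closed_add_line:
  fixes x :: "'a::complex_banach"
  assumes S: "cv.subspace S" "closed S"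
  shows "closed (cv.span (insert x S))"
proof (cases "x \<in> S")
  case True
  then show ?thesis using S by (simp add: insert_absorb cv.span_eq_iff[THEN iffD2])
next
  case False
  have mem: "y \<in> cv.span (insert x S) \<longleftrightarrow> (\<exists>k. y - k *\<^sub>C x \<in> S)" for y
    unfolding cv.span_insert using S(1) by (simp add: cv.span_eq_iff[THEN iffD2])
  have ne: "S \<noteq> {}" using S(1) cv.subspace_0 by blast
  define d where "d = infdist x S"
  have d: "d > 0" using False S(2) ne infdist_pos_not_in_closed unfolding d_def by blast
  have low: "cmod k * d \<le> norm (s + k *\<^sub>C x)" if "s \<in> S" for s k
  proof (cases "k = 0")
    case False
    have "d \<le> dist x ((- 1 / k) *\<^sub>C s)"
      unfolding d_def using that S(1) by (intro infdist_le cv.subspace_scale)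
    also have "x - (- 1 / k) *\<^sub>C s = (1 / k) *\<^sub>C (s + k *\<^sub>C x)"
      using False by (simp add: scaleC_add_right scaleC_scaleC scaleC_one)
    then have "dist x ((- 1 / k) *\<^sub>C s) = norm (s + k *\<^sub>C x) / cmod k"
      unfolding dist_norm by (simp only: norm_scaleC) (simp add: norm_divide)
    finally show ?thesis using False by (simp add: pos_le_divide_eq mult.commute)
  qed simp
  show ?thesis
    unfolding closed_sequential_limits
  proof (intro allI impI, elim conjE)
    fix y l assume y: "\<forall>n. y n \<in> cv.span (insert x S)" "y \<longlonglongrightarrow> l"
    then have "\<forall>n. \<exists>k. y n - k *\<^sub>C x \<in> S" unfolding mem by blast
    then obtain k where k: "\<And>n. y n - k n *\<^sub>C x \<in> S" by metis
    have "Cauchy k"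
    proof (rule metric_CauchyI)
      fix e :: real assume "e > 0"
      then obtain M where M: "\<And>m n. m \<ge> M \<Longrightarrow> n \<ge> M \<Longrightarrow> dist (y m) (y n) < e * d"
        using metric_CauchyD[OF LIMSEQ_imp_Cauchy[OF y(2)], of "e * d"] d by auto
      have "dist (k m) (k n) < e" if "m \<ge> M" "n \<ge> M" for m n
      proof -
        have "(y m - k m *\<^sub>C x) - (y n - k n *\<^sub>C x) \<in> S" using k S(1) cv.subspace_diff by blast
        from low[OF this, of "k m - k n"] have "cmod (k m - k n) * d \<le> norm (y m - y n)"
          by (simp add: cv.scale_left_diff_distrib)
        also have "\<dots> < e * d" using M[OF that] by (simp add: dist_norm)
        finally show ?thesis using d by (simp add: dist_norm)
      qed
      then show "\<exists>M. \<forall>m\<ge>M. \<forall>n\<ge>M. dist (k m) (k n) < e" by blast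
    qed
    then obtain c where c: "k \<longlonglongrightarrow> c" using Cauchy_convergent convergent_def by blast
    have "(\<lambda>n. (k n - c) *\<^sub>C x) \<longlonglongrightarrow> 0"
    proof (rule tendsto_norm_zero_cancel)
      have "(\<lambda>n. cmod (k n - c) * norm x) \<longlonglongrightarrow> 0"
        using c by (intro tendsto_mult_left_zero tendsto_norm_zero) (simp add: LIM_zero)
      then show "(\<lambda>n. norm ((k n - c) *\<^sub>C x)) \<longlonglongrightarrow> 0" by (simp add: norm_scaleC)
    qed
    then have "(\<lambda>n. y n - (k n - c) *\<^sub>C x) \<longlonglongrightarrow> l - 0" by (intro tendsto_diff y(2))
    then have "(\<lambda>n. (y n - (k n - c) *\<^sub>C x) - c *\<^sub>C x) \<longlonglongrightarrow> l - 0 - c *\<^sub>C x"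
      by (rule tendsto_diff[OF _ tendsto_const])
    moreover have "(y n - (k n - c) *\<^sub>C x) - c *\<^sub>C x = y n - k n *\<^sub>C x" for n
      by (simp add: cv.scale_left_diff_distrib)
    ultimately have "(\<lambda>n. y n - k n *\<^sub>C x) \<longlonglongrightarrow> l - c *\<^sub>C x" by simp
    then have "l - c *\<^sub>C x \<in> S" using closed_sequentially[OF S(2), of "\<lambda>n. y n - k n *\<^sub>C x"] k by blast
    then show "l \<in> cv.span (insert x S)" using mem by blast
  qed
qed

lemma closed_span_finite:
  fixes S :: "'a::complex_banach set"
  assumes "finite S" shows "closed (cv.span S)"
  using assms
proof (induction S)
  case (insert x S)
  have "cv.span (insert x (cv.span S)) = cv.span (insert x S)"
  proof
    show "cv.span (insert x (cv.span S)) \<subseteq> cv.span (insert x S)"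
      by (intro cv.span_minimal cv.subspace_span)
        (use cv.span_mono[of S "insert x S"] cv.span_base[of x "insert x S"] in auto)
    show "cv.span (insert x S) \<subseteq> cv.span (insert x (cv.span S))"
      using cv.span_superset[of S] by (intro cv.span_mono) auto
  qed
  then show ?case using closed_add_line[OF cv.subspace_span insert.IH, of x] by simp
qed simp

text \<open>Known as operator ranges. The \<open>itself\<close> argument records the type of the
  domain, over which a definition in HOL cannot quantify. Scalars are real because the open mapping
  theorem is used in its real form.\<close>

definition bounded_range :: "'c::banach itself \<Rightarrow> 'b::banach set \<Rightarrow> bool" where
  "bounded_range _ M \<longleftrightarrow> (\<exists>(V::'c set) v K. subspace V \<and> closed V \<and> lin_on scaleR scaleR V v
     \<and> (\<forall>x\<in>V. norm (v x) \<le> K * norm x) \<and> M = v ` V)"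

lemma bounded_rangeI:
  fixes V :: "'c::banach set"
  assumes "subspace V" "closed V" "lin_on scaleR scaleR V v" "\<And>x. x \<in> V \<Longrightarrow> norm (v x) \<le> K * norm x"
  shows "bounded_range TYPE('c) (v ` V)"
  using assms unfolding bounded_range_def by blast

lemma subspace_lin_preimage:
  assumes "lin_on scaleR scaleR S f" "subspace S" "subspace W" shows "subspace {x\<in>S. f x \<in> W}"
  using real_vector.subspace_preimage[OF assms(1,2) real_vector.vector_space_axioms, of W] assms(3)
  by (simp add: subspace_raw_def)

lemma tendsto_lin_bound:
  assumes "\<And>n. norm (f n) \<le> K * norm (g n)" "g \<longlonglongrightarrow> 0" shows "f \<longlonglongrightarrow> 0"
proof (rule Lim_null_comparison)
  show "\<forall>\<^sub>F n in sequentially. norm (f n) \<le> K * norm (g n)" using assms(1) by simp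
  show "(\<lambda>n. K * norm (g n)) \<longlonglongrightarrow> 0"
    using assms(2) by (intro tendsto_mult_right_zero tendsto_norm_zero)
qed

lemma closed_preimage_lin_on:
  fixes V :: "'c::real_normed_vector set" and W :: "'d::real_normed_vector set"
  assumes V: "subspace V" "closed V" and W: "closed W"
    and v: "lin_on scaleR scaleR V v" "\<And>x. x \<in> V \<Longrightarrow> norm (v x) \<le> K * norm x"
  shows "closed {x\<in>V. v x \<in> W}"
  unfolding closed_sequential_limits
proof (intro allI impI, elim conjE)
  fix x l assume x: "\<forall>n. x n \<in> {x\<in>V. v x \<in> W}" "x \<longlonglongrightarrow> l"
  then have l: "l \<in> V" using closed_sequentially[OF V(2)] by blast
  have "norm (v (x n) - v l) \<le> K * norm (x n - l)" for n
    using v(2)[of "x n - l"] x(1) l V(1)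
      real_vector.lin_on_diff[OF v(1) V(1) real_vector.vector_space_axioms, of "x n" l]
    by (simp add: subspace_diff)
  moreover have "(\<lambda>n. x n - l) \<longlonglongrightarrow> 0" using x(2) by (simp add: LIM_zero)
  ultimately have "(\<lambda>n. v (x n) - v l) \<longlonglongrightarrow> 0" by (rule tendsto_lin_bound)
  then have "(\<lambda>n. v (x n)) \<longlonglongrightarrow> v l" by (simp add: LIM_zero_iff)
  then have "v l \<in> W" using closed_sequentially[OF W, of "\<lambda>n. v (x n)"] x(1) by blast
  with l show "l \<in> {x\<in>V. v x \<in> W}" by blast
qed

text \<open>The sum map of the two domains is onto the closed space \<open>X\<close>, so for
  \<open>z n\<close> in \<open>R\<close> with limit \<open>l\<close> the differences
  \<open>z n - l\<close> have preimages \<open>p n\<close> tending to zero. Writing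
  \<open>l = u a + v b\<close>, uniqueness of the decomposition of \<open>z n\<close> makes
  \<open>v b\<close> the negative of \<open>v (snd (p n))\<close>, which tends to zero; thus
  \<open>v b = 0\<close> and \<open>l\<close> lies in \<open>R\<close>.\<close>

lemma bounded_range_complement_closed:
  fixes X R M :: "'a::banach set"
  assumes X: "closed X" "X = {r + m | r m. r \<in> R \<and> m \<in> M}" and RM: "R \<inter> M = {0}"
    and R: "bounded_range TYPE('b::banach) R" and M: "bounded_range TYPE('c::banach) M"
  shows "closed R"
proof -
  obtain U :: "'b set" and u K where U: "subspace U" "closed U" "lin_on scaleR scaleR U u"
    "\<And>x. x \<in> U \<Longrightarrow> norm (u x) \<le> K * norm x" "R = u ` U"
    using R unfolding bounded_range_def by blast
  obtain V :: "'c set" and v L where V: "subspace V" "closed V" "lin_on scaleR scaleR V v"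
    "\<And>x. x \<in> V \<Longrightarrow> norm (v x) \<le> L * norm x" "M = v ` V"
    using M unfolding bounded_range_def by blast
  define \<Psi> where "\<Psi> p = u (fst p) + v (snd p)" for p
  have sUV: "subspace (U \<times> V)" using U(1) V(1) by (rule subspace_Times)
  have cUV: "closed (U \<times> V)" using U(2) V(2) by (rule closed_Times)
  have lin: "lin_on scaleR scaleR (U \<times> V) \<Psi>"
    using U(3) V(3) by (auto simp: lin_on_def \<Psi>_def scaleR_add_right)
  have bd: "norm (\<Psi> p) \<le> (\<bar>K\<bar> + \<bar>L\<bar>) * norm p" if "p \<in> U \<times> V" for p
  proof -
    have "norm (u (fst p)) \<le> \<bar>K\<bar> * norm p"
    proof -
      have "norm (u (fst p)) \<le> K * norm (fst p)" using U(4) that by auto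
      also have "\<dots> \<le> \<bar>K\<bar> * norm p"
        using norm_fst_le[of "fst p" "snd p"] by (intro mult_mono) auto
      finally show ?thesis .
    qed
    moreover have "norm (v (snd p)) \<le> \<bar>L\<bar> * norm p"
    proof -
      have "norm (v (snd p)) \<le> L * norm (snd p)" using V(4) that by auto
      also have "\<dots> \<le> \<bar>L\<bar> * norm p"
        using norm_snd_le[of "snd p" "fst p"] by (intro mult_mono) auto
      finally show ?thesis .
    qed
    ultimately show ?thesis
      unfolding \<Psi>_def using norm_triangle_ineq[of "u (fst p)" "v (snd p)"] by (simp add: distrib_right)
  qed
  have im: "\<Psi> ` (U \<times> V) = X" unfolding X(2) U(5) V(5) \<Psi>_def by force
  obtain C where C: "\<And>y. y \<in> X \<Longrightarrow> \<exists>p\<in>U \<times> V. \<Psi> p = y \<and> norm p \<le> C * norm y"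
    using open_mapping_bound[OF sUV cUV lin bd] X(1) unfolding im by blast
  have sX: "subspace X" using subspace_lin_image[OF lin sUV] im by simp
  have sR: "subspace R" unfolding U(5) using subspace_lin_image[OF U(3,1)] .
  have RX: "R \<subseteq> X"
  proof
    fix r assume "r \<in> R"
    moreover have "0 \<in> M" using RM by blast
    ultimately show "r \<in> X" unfolding X(2) by force
  qed
  show ?thesis
    unfolding closed_sequential_limits
  proof (intro allI impI, elim conjE)
    fix z l assume z: "\<forall>n. z n \<in> R" "z \<longlonglongrightarrow> l"
    then have lX: "l \<in> X" using closed_sequentially[OF X(1)] RX by blast
    then obtain a b where ab: "a \<in> U" "b \<in> V" "l = u a + v b" using im unfolding \<Psi>_def by force
    have "\<exists>p\<in>U \<times> V. \<Psi> p = z n - l \<and> norm p \<le> C * norm (z n - l)" for n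
      using z(1) RX lX sX by (intro C subspace_diff) auto
    then obtain p where p: "\<And>n. p n \<in> U \<times> V" "\<And>n. \<Psi> (p n) = z n - l"
      "\<And>n. norm (p n) \<le> C * norm (z n - l)" by metis
    have "(\<lambda>n. z n - l) \<longlonglongrightarrow> 0" using z(2) by (simp add: LIM_zero)
    with p(3) have p0: "p \<longlonglongrightarrow> 0" by (rule tendsto_lin_bound)
    have vb: "v b + v (snd (p n)) = 0" for n
    proof -
      have m: "fst (p n) \<in> U" "snd (p n) \<in> V" using p(1)[of n] by (auto simp: mem_Times_iff)
      have "v b + v (snd (p n)) = z n - (u a + u (fst (p n)))"
        using p(2)[of n] ab(3) by (simp add: \<Psi>_def algebra_simps)
      also have "\<dots> \<in> R"
        using z(1) ab(1) m U(5) sR by (intro subspace_diff subspace_add) auto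
      finally have "v b + v (snd (p n)) \<in> R" .
      moreover have "v b + v (snd (p n)) \<in> M"
        unfolding V(5) using ab(2) m(2) lin_onD(1)[OF V(3) ab(2) m(2)] V(1)
        by (metis image_eqI subspace_add)
      ultimately show ?thesis using RM by blast
    qed
    have "norm (v b) \<le> L * norm (snd (p n))" for n
      using V(4)[of "snd (p n)"] p(1)[of n] vb[of n]
      by (metis add_eq_0_iff mem_Times_iff norm_minus_cancel)
    moreover have "(\<lambda>n. snd (p n)) \<longlonglongrightarrow> 0" using tendsto_snd[OF p0] by simp
    ultimately have "(\<lambda>n::nat. v b) \<longlonglongrightarrow> 0" by (rule tendsto_lin_bound)
    then have "v b = 0" by (simp add: tendsto_const_iff)
    then show "l \<in> R" using ab U(5) by simp
  qed
qed

text \<open>Induction on the dimension of the overlap. A functional with value 1 at a nonzero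
  \<open>r\<close> of the overlap cuts \<open>M\<close> down to its zeros, still a bounded range
  because the corresponding part of the domain is closed; the lost direction is recovered modulo
  \<open>R\<close>, since \<open>r\<close> belongs to \<open>R\<close>.\<close>

lemma bounded_range_disjoint_part:
  fixes R M :: "'a::complex_banach set"
  assumes "cv.subspace R" "cv.subspace M" "bounded_range TYPE('c::banach) M" "cofin scaleC {} (R \<inter> M)"
  shows "\<exists>M'. cv.subspace M' \<and> M' \<subseteq> M \<and> bounded_range TYPE('c) M' \<and> R \<inter> M' = {0}
    \<and> (\<forall>x\<in>M. \<exists>m\<in>M'. x - m \<in> R)"
  using assms(2-)
proof (induction "cv.dim (R \<inter> M)" arbitrary: M rule: less_induct)
  case less
  show ?case
  proof (cases "R \<inter> M = {0}")
    case True
    then show ?thesis using less.prems assms(1) by (intro exI[of _ M]) (auto simp: cv.subspace_0)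
  next
    case False
    then obtain r where r: "r \<in> R" "r \<in> M" "r \<noteq> 0"
      using assms(1) less.prems(1) cv.subspace_0 by blast
    obtain \<phi> :: "'a \<Rightarrow> complex" and K where \<phi>: "\<And>x y. \<phi> (x + y) = \<phi> x + \<phi> y"
      "\<And>c x. \<phi> (c *\<^sub>C x) = c * \<phi> x" "\<And>x. cmod (\<phi> x) \<le> K * norm x" "\<phi> r = 1"
      using hahn_banach_functional[OF r(3)] by metis
    have "bounded_linear \<phi>"
      by (rule bounded_linear_intro[of _ K])
        (simp_all add: \<phi>(1,2) scaleR_scaleC mult.commute[of _ K] \<phi>(3) scaleR_conv_of_real)
    then have "continuous_on UNIV \<phi>" by (rule linear_continuous_on)
    then have "closed (\<phi> -` {0})" by (intro closed_vimage) auto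
    then have ker: "closed {x. \<phi> x = 0}" by (simp add: vimage_def)
    define M1 where "M1 = {m\<in>M. \<phi> m = 0}"
    have \<phi>0: "\<phi> 0 = 0" using \<phi>(2)[of 0 0] by simp
    have sM1: "cv.subspace M1"
      using less.prems(1) unfolding M1_def cv.subspace_def by (auto simp: \<phi> \<phi>0)
    have bM1: "bounded_range TYPE('c) M1"
    proof -
      obtain V :: "'c set" and v L where V: "subspace V" "closed V" "lin_on scaleR scaleR V v"
        "\<And>x. x \<in> V \<Longrightarrow> norm (v x) \<le> L * norm x" "M = v ` V"
        using less.prems(2) unfolding bounded_range_def by blast
      let ?V = "{p\<in>V. v p \<in> {x. \<phi> x = 0}}"
      have "subspace {x. \<phi> x = 0}"
        unfolding subspace_def by (simp add: \<phi> \<phi>0 scaleR_scaleC)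
      with V(3,1) have "subspace ?V" by (rule subspace_lin_preimage)
      moreover have "closed ?V" using V(1,2) ker V(3,4) by (rule closed_preimage_lin_on)
      moreover have "lin_on scaleR scaleR ?V v" by (rule lin_on_subset[OF V(3)]) auto
      ultimately have "bounded_range TYPE('c) (v ` ?V)" using V(4) by (rule bounded_rangeI) auto
      moreover have "v ` ?V = M1" unfolding M1_def V(5) by auto
      ultimately show ?thesis by simp
    qed
    obtain S where S: "finite S" "R \<inter> M \<subseteq> cv.span S"
      using less.prems(3) unfolding cofin_def by auto
    obtain B where B: "B \<subseteq> R \<inter> M" "cv.independent B" "R \<inter> M \<subseteq> cv.span B" "card B = cv.dim (R \<inter> M)"
      by (rule cv.basis_exists)
    obtain B1 where B1: "B1 \<subseteq> R \<inter> M1" "cv.independent B1" "R \<inter> M1 \<subseteq> cv.span B1" "card B1 = cv.dim (R \<inter> M1)"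
      by (rule cv.basis_exists)
    \<comment> \<open>\<open>cv.dim\<close> is the cardinality of a basis, so it measures a decrease
      only if \<open>B\<close> is finite, which the finite spanning set provides.\<close>
    have fB: "finite B" using cv.independent_span_bound[OF S(1) B(2)] B(1) S(2) by blast
    \<comment> \<open>\<open>\<phi>\<close> vanishes on the span of \<open>B1\<close> but not at
      \<open>r\<close>, so adding \<open>r\<close> to \<open>B1\<close> gives a strictly larger
      independent set within the span of \<open>B\<close>.\<close>
    have "cv.span B1 \<subseteq> M1" using B1(1) sM1 by (intro cv.span_minimal) auto
    then have rB1: "r \<notin> cv.span B1" unfolding M1_def using \<phi>(4) by auto
    then have ind: "cv.independent (insert r B1)" using B1(2) by (rule cv.independent_insertI)
    have "insert r B1 \<subseteq> cv.span B" using B(3) B1(1) r unfolding M1_def by blast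
    then have "finite (insert r B1)" "card (insert r B1) \<le> card B"
      using cv.independent_span_bound[OF fB ind] by auto
    moreover have "r \<notin> B1" using rB1 cv.span_base by blast
    ultimately have dim: "cv.dim (R \<inter> M1) < cv.dim (R \<inter> M)" using B(4) B1(4) by simp
    have "cofin scaleC {} (R \<inter> M1)"
      using less.prems(3) by (rule cv.cofin_mono) (auto simp: M1_def)
    from less.hyps[OF dim sM1 bM1 this]
    obtain M' where M': "cv.subspace M'" "M' \<subseteq> M1" "bounded_range TYPE('c) M'" "R \<inter> M' = {0}"
      "\<forall>x\<in>M1. \<exists>m\<in>M'. x - m \<in> R" by (elim exE conjE) (rule that)
    have "\<exists>m\<in>M'. x - m \<in> R" if x: "x \<in> M" for x
    proof -
      have "x - \<phi> x *\<^sub>C r \<in> M"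
        using x r(2) less.prems(1) by (intro cv.subspace_diff cv.subspace_scale)
      moreover have "\<phi> (x - y) = \<phi> x - \<phi> y" for y using \<phi>(1)[of "x - y" y] by simp
      ultimately have "x - \<phi> x *\<^sub>C r \<in> M1" by (simp add: M1_def \<phi>)
      then obtain m where m: "m \<in> M'" "x - \<phi> x *\<^sub>C r - m \<in> R" using M'(5) by blast
      then have "(x - \<phi> x *\<^sub>C r - m) + \<phi> x *\<^sub>C r \<in> R"
        using r(1) assms(1) by (intro cv.subspace_add cv.subspace_scale)
      then show ?thesis using m(1) by (intro bexI[of _ m]) simp_all
    qed
    then show ?thesis using M' unfolding M1_def by (intro exI[of _ M']) auto
  qed
qed

text \<open>A generator is kept only if it is not yet in the span of \<open>N\<close> and those
  already kept. It then cannot enter a vector of \<open>N\<close> with nonzero coefficient, so the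
  intersection stays trivial.\<close>

lemma finite_dim_complement:
  fixes N :: "'a::complex_vector set"
  assumes "finite S" "cv.subspace N"
  shows "\<exists>S0\<subseteq>S. N \<inter> cv.span S0 = {0} \<and> S \<subseteq> cv.span (N \<union> S0)"
  using assms(1)
proof (induction S)
  case empty
  then show ?case using assms(2) cv.subspace_0 by auto
next
  case (insert s S)
  then obtain S0 where S0: "S0 \<subseteq> S" "N \<inter> cv.span S0 = {0}" "S \<subseteq> cv.span (N \<union> S0)" by blast
  show ?case
  proof (cases "s \<in> cv.span (N \<union> S0)")
    case True
    then show ?thesis using S0 by (intro exI[of _ S0]) auto
  next
    case False
    have "n = 0" if n: "n \<in> N" "n \<in> cv.span (insert s S0)" for n
    proof -
      obtain k where k: "n - k *\<^sub>C s \<in> cv.span S0" using n(2) unfolding cv.span_insert by blast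
      have "k = 0"
      proof (rule ccontr)
        assume "k \<noteq> 0"
        have 1: "n - k *\<^sub>C s \<in> cv.span (N \<union> S0)" using k cv.span_mono[of S0 "N \<union> S0"] by blast
        have "n \<in> cv.span (N \<union> S0)" using n(1) by (simp add: cv.span_base)
        from cv.span_diff[OF this 1] have "k *\<^sub>C s \<in> cv.span (N \<union> S0)" by simp
        then have "(1 / k) *\<^sub>C (k *\<^sub>C s) \<in> cv.span (N \<union> S0)" by (rule cv.span_scale)
        then show False using False \<open>k \<noteq> 0\<close> by simp
      qed
      then show ?thesis using k n(1) S0(2) by auto
    qed
    then have "N \<inter> cv.span (insert s S0) = {0}"
      using cv.subspace_0[OF assms(2)] cv.span_zero[of "insert s S0"] by blast
    moreover have "insert s S \<subseteq> cv.span (N \<union> insert s S0)"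
      using S0(3) cv.span_mono[of "N \<union> S0" "N \<union> insert s S0"] by (auto intro: cv.span_base)
    ultimately show ?thesis using S0(1) by (intro exI[of _ "insert s S0"]) auto
  qed
qed

text \<open>The complement is \<open>W\<close>, the sum of \<open>M'\<close> and \<open>E\<close>:
  \<open>M'\<close> is a subspace of \<open>M\<close> that meets \<open>R\<close> in zero without
  losing anything modulo \<open>R\<close>, and the finite-dimensional \<open>E\<close> fills what
  \<open>R\<close> and \<open>M'\<close> miss. Both \<open>R\<close> and \<open>W\<close> are
  bounded ranges and \<open>X\<close> is their direct sum, so each is closed on account of the
  other.\<close>

theorem bounded_range_top_complemented:
  fixes X R M :: "'a::complex_banach set"
  assumes X: "cv.subspace X" "closed X" and R: "cv.subspace R" "R \<subseteq> X" "bounded_range TYPE('b::banach) R"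
    and M: "cv.subspace M" "M \<subseteq> X" "bounded_range TYPE('c::banach) M"
    and RM: "cofin scaleC {} (R \<inter> M)" "cofin scaleC (R \<union> M) X"
  shows "top_complemented R X"
proof -
  obtain M' where M': "cv.subspace M'" "M' \<subseteq> M" "bounded_range TYPE('c) M'" "R \<inter> M' = {0}"
    "\<forall>x\<in>M. \<exists>m\<in>M'. x - m \<in> R"
    using bounded_range_disjoint_part[OF R(1) M(1,3) RM(1)] by (elim exE conjE) (rule that)
  define N where "N = {r + m |r m. r \<in> R \<and> m \<in> M'}"
  have sN: "cv.subspace N" unfolding N_def using R(1) M'(1) by (rule cv.subspace_sums)
  have RN: "R \<subseteq> N" and M'N: "M' \<subseteq> N"
    unfolding N_def using cv.subspace_0[OF M'(1)] cv.subspace_0[OF R(1)] by force+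
  have NX: "N \<subseteq> X" unfolding N_def using R(2) M'(2) M(2) by (auto intro!: cv.subspace_add[OF X(1)])
  have "x \<in> N" if "x \<in> M" for x
  proof -
    obtain m where "m \<in> M'" "x - m \<in> R" using M'(5) \<open>x \<in> M\<close> by blast
    then have "x = (x - m) + m" "x - m \<in> R" "m \<in> M'" by simp_all
    then show ?thesis unfolding N_def by blast
  qed
  then have "cofin scaleC N X" using RN by (intro cv.cofin_mono[OF RM(2)]) auto
  then obtain S where S: "finite S" "S \<subseteq> X" "X \<subseteq> cv.span (N \<union> S)"
    using cv.cofin_strong[OF X(1) sN NX] by blast
  obtain S0 where S0: "S0 \<subseteq> S" "N \<inter> cv.span S0 = {0}" "S \<subseteq> cv.span (N \<union> S0)"
    using finite_dim_complement[OF S(1) sN] by blast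
  define E where "E = cv.span S0"
  have sE: "cv.subspace E" and cE: "closed E"
    unfolding E_def using closed_span_finite finite_subset[OF S0(1) S(1)] by auto
  have EX: "E \<subseteq> X" unfolding E_def using S0(1) S(2) X(1) by (intro cv.span_minimal) auto
  have "cv.span (N \<union> S) \<subseteq> cv.span (N \<union> S0)"
    using S0(3) by (intro cv.span_minimal cv.subspace_span) (auto intro: cv.span_base)
  then have XNE: "X \<subseteq> {n + e |n e. n \<in> N \<and> e \<in> E}"
    using S(3) sN unfolding cv.span_Un E_def by (simp add: cv.span_eq_iff[THEN iffD2])
  define W where "W = {m + e |m e. m \<in> M' \<and> e \<in> E}"
  have sW: "cv.subspace W" unfolding W_def using M'(1) sE by (rule cv.subspace_sums)
  have WX: "W \<subseteq> X" unfolding W_def using M'N NX EX by (auto intro!: cv.subspace_add[OF X(1)])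
  have RW: "R \<inter> W = {0}"
  proof -
    have "x = 0" if x: "x \<in> R" "x \<in> W" for x
    proof -
      obtain m e where me: "m \<in> M'" "e \<in> E" "x = m + e" using x(2) unfolding W_def by blast
      have "x - m \<in> N" using x(1) me(1) RN M'N by (intro cv.subspace_diff[OF sN]) auto
      then have "e = 0" using me S0(2) unfolding E_def by auto
      then show ?thesis using x(1) me M'(4) by auto
    qed
    then show ?thesis using cv.subspace_0[OF R(1)] cv.subspace_0[OF sW] by blast
  qed
  have XRW: "X = {r + w |r w. r \<in> R \<and> w \<in> W}"
  proof
    show "X \<subseteq> {r + w |r w. r \<in> R \<and> w \<in> W}"
    proof
      fix x assume "x \<in> X"
      then obtain r m e where "r \<in> R" "m \<in> M'" "e \<in> E" "x = r + m + e"
        using XNE unfolding N_def by blast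
      then have "x = r + (m + e)" "r \<in> R" "m + e \<in> W" unfolding W_def by (auto simp: add.assoc)
      then show "x \<in> {r + w |r w. r \<in> R \<and> w \<in> W}" by blast
    qed
    show "{r + w |r w. r \<in> R \<and> w \<in> W} \<subseteq> X" using R(2) WX by (auto intro!: cv.subspace_add[OF X(1)])
  qed
  \<comment> \<open>\<open>W\<close> is the range of the sum map on the product of a domain for
    \<open>M'\<close> with \<open>E\<close>, which is complete since finite-dimensional subspaces
    are closed.\<close>
  have bW: "bounded_range TYPE('c \<times> 'a) W"
  proof -
    obtain V :: "'c set" and v L where V: "subspace V" "closed V" "lin_on scaleR scaleR V v"
      "\<And>x. x \<in> V \<Longrightarrow> norm (v x) \<le> L * norm x" "M' = v ` V"
      using M'(3) unfolding bounded_range_def by blast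
    define w where "w p = v (fst p) + snd p" for p
    have "bounded_range TYPE('c \<times> 'a) (w ` (V \<times> E))"
    proof (rule bounded_rangeI)
      show "subspace (V \<times> E)" using V(1) csubspace_imp_subspace[OF sE] by (rule subspace_Times)
      show "closed (V \<times> E)" using V(2) cE by (rule closed_Times)
      show "lin_on scaleR scaleR (V \<times> E) w"
        using V(3) by (auto simp: lin_on_def w_def scaleR_add_right)
      fix p assume p: "p \<in> V \<times> E"
      have "norm (v (fst p)) \<le> L * norm (fst p)" using V(4) p by auto
      also have "\<dots> \<le> \<bar>L\<bar> * norm p" using norm_fst_le[of "fst p" "snd p"] by (intro mult_mono) auto
      finally show "norm (w p) \<le> (\<bar>L\<bar> + 1) * norm p"
        using norm_triangle_ineq[of "v (fst p)" "snd p"] norm_snd_le[of "snd p" "fst p"]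
        unfolding w_def by (simp add: distrib_right)
    qed
    moreover have "w ` (V \<times> E) = W" unfolding w_def W_def V(5) by force
    ultimately show ?thesis by simp
  qed
  have "closed R" using X(2) XRW RW R(3) bW by (rule bounded_range_complement_closed)
  moreover have "closed W"
  proof (rule bounded_range_complement_closed[OF X(2) _ _ bW R(3)])
    show "X = {r + m |r m. r \<in> W \<and> m \<in> R}" unfolding XRW by (metis (no_types, opaque_lifting) add.commute)
    show "W \<inter> R = {0}" using RW by blast
  qed
  ultimately show ?thesis
    unfolding top_complemented_def csubspace_iff using R(1,2) sW WX RW XRW by blast
qed

section \<open>Triangular operator matrices\<close>

interpretation cf: vector_space "scaleC_fun :: complex \<Rightarrow> (nat \<Rightarrow> 'a) \<Rightarrow> nat \<Rightarrow> 'a::complex_vector"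
  by unfold_locales
    (simp_all add: scaleC_fun_def fun_eq_iff scaleC_add_right scaleC_add_left scaleC_scaleC scaleC_one)

lemma bounded_op_lin_on: "bounded_op X Y T \<Longrightarrow> lin_on scaleC scaleC X T"
  by (simp add: bounded_op_def lin_on_def)

lemma bounded_op_mem: "bounded_op X Y T \<Longrightarrow> x \<in> X \<Longrightarrow> T x \<in> Y"
  by (simp add: bounded_op_def)

lemma bounded_op_bound:
  assumes "bounded_op X Y T"
  obtains K where "K \<ge> 0" "\<And>x. x \<in> X \<Longrightarrow> norm (T x) \<le> K * norm x"
proof -
  obtain K where K: "\<And>x. x \<in> X \<Longrightarrow> norm (T x) \<le> K * norm x" using assms unfolding bounded_op_def by blast
  have "norm (T x) \<le> \<bar>K\<bar> * norm x" if "x \<in> X" for x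
    using order_trans[OF K[OF that] mult_right_mono[of K "\<bar>K\<bar>" "norm x"]] by simp
  then show thesis using that[of "\<bar>K\<bar>"] by simp
qed

lemma lin_on_real:
  fixes T :: "'a::complex_vector \<Rightarrow> 'b::complex_vector"
  shows "lin_on scaleC scaleC X T \<Longrightarrow> lin_on scaleR scaleR X T"
  by (simp add: lin_on_def scaleR_scaleC)

lemma bounded_op_tendsto:
  assumes T: "bounded_op X Y T" and X: "cv.subspace X"
    and x: "\<And>n. x n \<in> X" "l \<in> X" "x \<longlonglongrightarrow> l"
  shows "(\<lambda>n. T (x n)) \<longlonglongrightarrow> T l"
proof -
  obtain K where K: "\<And>x. x \<in> X \<Longrightarrow> norm (T x) \<le> K * norm x" using bounded_op_bound[OF T] by metis
  have "norm (T (x n) - T l) \<le> K * norm (x n - l)" for n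
    using K[of "x n - l"] cv.subspace_diff[OF X x(1) x(2), of n]
      cv.lin_on_diff[OF bounded_op_lin_on[OF T] X cv.vector_space_axioms x(1) x(2), of n] by simp
  moreover have "(\<lambda>n. x n - l) \<longlonglongrightarrow> 0" using x(3) by (simp add: LIM_zero)
  ultimately have "(\<lambda>n. T (x n) - T l) \<longlonglongrightarrow> 0" by (rule tendsto_lin_bound)
  then show ?thesis by (simp add: LIM_zero_iff)
qed

section \<open>Direct sums inside a Banach space of bounded sequences\<close>

text \<open>The completeness instance of bounded continuous functions demands a metric domain; it makes
  the bounded sequences a Banach space, which contains the finite direct sums.\<close>

instantiation nat :: metric_space
begin

definition dist_nat :: "nat \<Rightarrow> nat \<Rightarrow> real" where
  "dist_nat m n = \<bar>real m - real n\<bar>"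

definition uniformity_nat :: "(nat \<times> nat) filter" where
  "uniformity_nat = (INF e\<in>{0 <..}. principal {(m, n). dist m n < e})"

instance
proof
  show "uniformity = (INF e\<in>{0 <..}. principal {(m, n :: nat). dist m n < e})"
    by (rule uniformity_nat_def)
  \<comment> \<open>Different naturals have distance at least 1, so the metric induces the discrete
    topology that \<open>nat\<close> carries already.\<close>
  have small: "dist m n < 1 \<longleftrightarrow> m = n" for m n :: nat
    unfolding dist_nat_def by linarith
  have ev: "eventually P (uniformity :: (nat \<times> nat) filter) \<longleftrightarrow> (\<exists>e>0. \<forall>m n. dist m n < e \<longrightarrow> P (m, n))" for P
    unfolding uniformity_nat_def
    by (subst eventually_INF_base)
      (auto simp: eventually_principal intro: bexI[of _ "min _ _"])
  show "open U \<longleftrightarrow> (\<forall>x\<in>U. \<forall>\<^sub>F (x', y) in uniformity. x' = x \<longrightarrow> y \<in> U)" for U :: "nat set"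
    using small by (auto simp: ev open_discrete intro!: exI[of _ 1])
  show "dist x y = 0 \<longleftrightarrow> x = y" for x y :: nat by (simp add: dist_nat_def)
  show "dist x y \<le> dist x z + dist y z" for x y z :: nat by (simp add: dist_nat_def)
qed

end

instance bcontfun :: (metric_space, banach) banach ..

text \<open>Elements of \<open>P\<close> vanish outside \<open>{1..n}\<close>, hence are bounded
  sequences, and \<open>P\<close> corresponds to a subspace \<open>V\<close> of a Banach space.
  Convergence in the sup norm implies coordinatewise convergence, so \<open>cl\<close> makes
  \<open>V\<close> closed.\<close>

lemma bounded_range_dsum:
  fixes P :: "(nat \<Rightarrow> 'a::complex_banach) set" and w :: "(nat \<Rightarrow> 'a) \<Rightarrow> 'a"
  assumes P: "cf.subspace P" "P \<subseteq> dsum n X"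
    and cl: "\<And>y l. (\<And>j. y j \<in> P) \<Longrightarrow> (\<And>k. (\<lambda>j. y j k) \<longlonglongrightarrow> l k) \<Longrightarrow> l \<in> P"
    and w: "lin_on scaleC_fun scaleC P w"
    and K: "\<And>y. y \<in> P \<Longrightarrow> norm (w y) \<le> K * (\<Sum>k\<in>{1..n}. norm (y k))"
  shows "bounded_range TYPE(nat \<Rightarrow>\<^sub>C 'a) (w ` P)"
proof -
  define V where "V = {b :: nat \<Rightarrow>\<^sub>C 'a. apply_bcontfun b \<in> P}"
  have plus: "apply_bcontfun (a + b) = apply_bcontfun a + apply_bcontfun b" for a b :: "nat \<Rightarrow>\<^sub>C 'a"
    by (simp add: fun_eq_iff)
  have scale: "apply_bcontfun (r *\<^sub>R a) = scaleC_fun (complex_of_real r) (apply_bcontfun a)" for r and a :: "nat \<Rightarrow>\<^sub>C 'a"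
    by (simp add: fun_eq_iff scaleC_fun_def scaleR_scaleC)
  have zero: "apply_bcontfun (0 :: nat \<Rightarrow>\<^sub>C 'a) = 0" by (simp add: fun_eq_iff)
  have "bounded_range TYPE(nat \<Rightarrow>\<^sub>C 'a) ((\<lambda>b. w (apply_bcontfun b)) ` V)"
  proof (rule bounded_rangeI)
    show "subspace V"
      unfolding subspace_def V_def mem_Collect_eq plus scale zero Ball_def
      by (intro conjI allI impI cf.subspace_0[OF P(1)] cf.subspace_add[OF P(1)] cf.subspace_scale[OF P(1)])
    show "closed V"
      unfolding closed_sequential_limits
    proof (intro allI impI, elim conjE)
      fix b l assume b: "\<forall>j. b j \<in> V" "b \<longlonglongrightarrow> l"
      have "(\<lambda>j. apply_bcontfun (b j) k) \<longlonglongrightarrow> apply_bcontfun l k" for k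
      proof -
        have "norm (apply_bcontfun (b j) k - apply_bcontfun l k) \<le> 1 * norm (b j - l)" for j
          using norm_bounded[of "b j - l" k] by simp
        moreover have "(\<lambda>j. b j - l) \<longlonglongrightarrow> 0" using b(2) by (simp add: LIM_zero)
        ultimately have "(\<lambda>j. apply_bcontfun (b j) k - apply_bcontfun l k) \<longlonglongrightarrow> 0"
          by (rule tendsto_lin_bound)
        then show ?thesis by (simp add: LIM_zero_iff)
      qed
      then show "l \<in> V" using cl[of "\<lambda>j. apply_bcontfun (b j)" "apply_bcontfun l"] b(1)
        unfolding V_def by blast
    qed
    show "lin_on scaleR scaleR V (\<lambda>b. w (apply_bcontfun b))"
      using w unfolding lin_on_def V_def plus scale scaleR_scaleC by simp
    fix b assume "b \<in> V"
    then have "norm (w (apply_bcontfun b)) \<le> K * (\<Sum>k\<in>{1..n}. norm (apply_bcontfun b k))"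
      unfolding V_def using K by blast
    \<comment> \<open>Each of the \<open>n\<close> coordinates is at most the sup norm, whence the
      factor \<open>n\<close> in the final bound.\<close>
    also have "\<dots> \<le> \<bar>K\<bar> * (\<Sum>k\<in>{1..n}. norm b)"
      by (intro mult_mono sum_mono norm_bounded sum_nonneg) auto
    finally show "norm (w (apply_bcontfun b)) \<le> (\<bar>K\<bar> * n) * norm b" by simp
  qed
  moreover have "apply_bcontfun ` V = P"
  proof
    show "P \<subseteq> apply_bcontfun ` V"
    proof
      fix y assume y: "y \<in> P"
      have "norm (y k) \<le> (\<Sum>k\<in>{1..n}. norm (y k))" for k
      proof (cases "k \<in> {1..n}")
        case True
        then show ?thesis by (intro member_le_sum) auto
      next
        case False
        then have "y k = 0" using P(2) y unfolding dsum_def by blast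
        then show ?thesis by (simp add: sum_nonneg)
      qed
      then have "y \<in> bcontfun" by (intro bcontfun_normI) auto
      then obtain b where "y = apply_bcontfun b" by (rule bcontfunE)
      then show "y \<in> apply_bcontfun ` V" using y unfolding V_def by blast
    qed
  qed (auto simp: V_def)
  ultimately show ?thesis by (metis image_image)
qed

lemma sum_enat_infinity: "finite S \<Longrightarrow> s \<in> S \<Longrightarrow> f s = \<infinity> \<Longrightarrow> (\<Sum>s\<in>S. f s :: enat) = \<infinity>"
  by (simp add: sum.remove)

section \<open>Compressions of the triangular operator\<close>

locale triangular_operator =
  fixes n :: nat and X :: "nat \<Rightarrow> 'a::complex_banach set" and T A
  assumes n: "n \<ge> 1"
    and X: "k \<in> {1..n} \<Longrightarrow> banach_subspace (X k)"
    and T: "k \<in> {1..n} \<Longrightarrow> bounded_op (X k) (X k) (T k)"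
    and A: "1 \<le> i \<Longrightarrow> i < j \<Longrightarrow> j \<le> n \<Longrightarrow> bounded_op (X j) (X i) (A i j)"
begin

abbreviation "F k \<equiv> tri_matrix k T A"
abbreviation "H k \<equiv> dsum k X"

lemma sX: "k \<in> {1..n} \<Longrightarrow> cv.subspace (X k)" and cX: "k \<in> {1..n} \<Longrightarrow> closed (X k)"
  using X by (auto simp: banach_subspace_def csubspace_iff)

lemma T0: "k \<in> {1..n} \<Longrightarrow> T k 0 = 0"
  using cv.lin_on_zero[OF bounded_op_lin_on[OF T] sX cv.vector_space_axioms] by blast

lemma A0: "1 \<le> i \<Longrightarrow> i < j \<Longrightarrow> j \<le> n \<Longrightarrow> A i j 0 = 0"
  using cv.lin_on_zero[OF bounded_op_lin_on[OF A] sX cv.vector_space_axioms, of i j] by simp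

lemma subspace_H: "k \<le> n \<Longrightarrow> cf.subspace (H k)"
  using sX unfolding cf.subspace_def dsum_def
  by (auto simp: scaleC_fun_def intro!: cv.subspace_0 cv.subspace_add cv.subspace_scale)

lemma H_nth: "x \<in> H k \<Longrightarrow> i \<in> {1..k} \<Longrightarrow> x i \<in> X i"
  by (simp add: dsum_def)

lemma F_lin: assumes "k \<le> n" shows "lin_on scaleC_fun scaleC_fun (H k) (F k)"
proof -
  have "F k (x + y) i = F k x i + F k y i" if "x \<in> H k" "y \<in> H k" for x y i
  proof (cases "i \<in> {1..k}")
    case True
    have "(\<Sum>j\<in>{i<..k}. A i j (x j + y j)) = (\<Sum>j\<in>{i<..k}. A i j (x j) + A i j (y j))"
      using True assms that
      by (intro sum.cong refl lin_onD(1)[OF bounded_op_lin_on[OF A]] H_nth) auto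
    moreover have "T i (x i + y i) = T i (x i) + T i (y i)"
      using True assms that by (intro lin_onD(1)[OF bounded_op_lin_on[OF T]] H_nth) auto
    ultimately show ?thesis using True by (simp add: tri_matrix_def sum.distrib)
  qed (auto simp: tri_matrix_def)
  moreover have "F k (scaleC_fun c x) i = c *\<^sub>C F k x i" if "x \<in> H k" for x c i
  proof (cases "i \<in> {1..k}")
    case True
    have "(\<Sum>j\<in>{i<..k}. A i j (c *\<^sub>C x j)) = (\<Sum>j\<in>{i<..k}. c *\<^sub>C A i j (x j))"
      using True assms that
      by (intro sum.cong refl lin_onD(2)[OF bounded_op_lin_on[OF A]] H_nth) auto
    moreover have "T i (c *\<^sub>C x i) = c *\<^sub>C T i (x i)"
      using True assms that by (intro lin_onD(2)[OF bounded_op_lin_on[OF T]] H_nth) auto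
    ultimately show ?thesis
      using True by (simp add: tri_matrix_def scaleC_fun_def scaleC_add_right cv.scale_sum_right)
  qed (auto simp: tri_matrix_def)
  ultimately show ?thesis by (simp add: lin_on_def fun_eq_iff scaleC_fun_def)
qed

lemma F_mem: assumes "k \<le> n" "x \<in> H k" shows "F k x \<in> H k"
proof -
  have "T i (x i) + (\<Sum>j\<in>{i<..k}. A i j (x j)) \<in> X i" if "i \<in> {1..k}" for i
    using that assms
    by (intro cv.subspace_add cv.subspace_sum sX bounded_op_mem[OF T] bounded_op_mem[OF A] H_nth) auto
  then show ?thesis unfolding dsum_def[of k] by (simp add: tri_matrix_def)
qed

lemma H_Suc: assumes "Suc k \<le> n" shows "{h\<in>H (Suc k). h (Suc k) = 0} = H k"
proof -
  have "0 \<in> X (Suc k)" by (intro cv.subspace_0 sX) (use assms in auto)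
  then show ?thesis unfolding dsum_def by (auto simp: le_Suc_eq)
qed

lemma F_Suc: assumes "Suc k \<le> n" "x \<in> H k" shows "F (Suc k) x = F k x"
proof
  have x: "x (Suc k) = 0" using assms unfolding dsum_def by simp
  fix i
  consider "i \<in> {1..k}" | "i = Suc k" | "i \<notin> {1..Suc k}" by fastforce
  then show "F (Suc k) x i = F k x i"
  proof cases
    case 1
    then have "{i<..Suc k} = insert (Suc k) {i<..k}" by auto
    then show ?thesis using 1 x A0[of i "Suc k"] assms by (simp add: tri_matrix_def)
  qed (use x T0[of "Suc k"] assms in \<open>auto simp: tri_matrix_def\<close>)
qed

text \<open>By upper triangularity the last row holds only the diagonal entry, so reading off the
  last coordinate intertwines \<open>F (Suc k)\<close> with \<open>T (Suc k)\<close>; what this map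
  kills is \<open>H k\<close>, by \<open>H_Suc\<close>.\<close>

lemma F_extension:
  assumes "Suc k \<le> n"
  shows "operator_extension scaleC_fun scaleC (H (Suc k)) (X (Suc k)) (F (Suc k)) (T (Suc k)) (\<lambda>x. x (Suc k))"
proof
  show "(\<lambda>x. x (Suc k)) ` H (Suc k) = X (Suc k)"
  proof
    show "X (Suc k) \<subseteq> (\<lambda>x. x (Suc k)) ` H (Suc k)"
    proof
      fix x assume "x \<in> X (Suc k)"
      then have "(\<lambda>i. if i = Suc k then x else 0) \<in> H (Suc k)"
        using sX assms unfolding dsum_def by (auto intro!: cv.subspace_0)
      then show "x \<in> (\<lambda>x. x (Suc k)) ` H (Suc k)" by (intro image_eqI) auto
    qed
  qed (auto simp: dsum_def)
  show "F (Suc k) h (Suc k) = T (Suc k) (h (Suc k))" if "h \<in> H (Suc k)" for h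
    by (simp add: tri_matrix_def)
qed (use assms subspace_H sX F_lin F_mem bounded_op_lin_on[OF T] bounded_op_mem[OF T] in
    \<open>auto simp: lin_on_def scaleC_fun_def\<close>)

lemma fin_F_G:
  assumes "Suc k \<le> n"
  shows "fin_alpha scaleC_fun {h\<in>H (Suc k). h (Suc k) = 0} (F (Suc k)) \<longleftrightarrow> fin_alpha scaleC_fun (H k) (F k)"
    and "fin_beta scaleC_fun {h\<in>H (Suc k). h (Suc k) = 0} (F (Suc k)) \<longleftrightarrow> fin_beta scaleC_fun (H k) (F k)"
proof -
  have "{x\<in>H k. F (Suc k) x = 0} = {x\<in>H k. F k x = 0}" "F (Suc k) ` H k = F k ` H k"
    using F_Suc[OF assms] by auto
  then show "fin_alpha scaleC_fun {h\<in>H (Suc k). h (Suc k) = 0} (F (Suc k)) \<longleftrightarrow> fin_alpha scaleC_fun (H k) (F k)"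
    and "fin_beta scaleC_fun {h\<in>H (Suc k). h (Suc k) = 0} (F (Suc k)) \<longleftrightarrow> fin_beta scaleC_fun (H k) (F k)"
    unfolding H_Suc[OF assms] fin_alpha_def fin_beta_def by simp_all
qed

abbreviation "a k \<equiv> fin_alpha scaleC (X k) (T k)"
abbreviation "b k \<equiv> fin_beta scaleC (X k) (T k)"
abbreviation "Fa k \<equiv> fin_alpha scaleC_fun (H k) (F k)"
abbreviation "Fb k \<equiv> fin_beta scaleC_fun (H k) (F k)"

text \<open>The zero space as starting point makes \<open>T 1\<close> the quotient of an extension
  like every other diagonal entry, so the inductions need no separate case for it.\<close>

lemma F_0: "Fa 0" "Fb 0"
proof -
  have "H 0 = {0}" unfolding dsum_def by (auto simp: fun_eq_iff)
  then have "{x\<in>H 0. F 0 x = 0} \<subseteq> {0}" "H 0 \<subseteq> {0}" by auto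
  then show "Fa 0" "Fb 0" unfolding fin_alpha_def fin_beta_def
    by (intro cf.cofin_span_superset; use cf.span_zero in blast)+
qed

lemma Fa_Suc: "Suc k \<le> n \<Longrightarrow> Fa k \<Longrightarrow> a (Suc k) \<Longrightarrow> Fa (Suc k)"
  using operator_extension.extension_alpha[OF F_extension] fin_F_G(1) by blast

lemma Fb_Suc: "Suc k \<le> n \<Longrightarrow> Fb k \<Longrightarrow> b (Suc k) \<Longrightarrow> Fb (Suc k)"
  using operator_extension.extension_beta[OF F_extension] fin_F_G(2) by blast

lemma b_if_Fb: "Suc k \<le> n \<Longrightarrow> Fb (Suc k) \<Longrightarrow> b (Suc k)"
  using operator_extension.quotient_beta[OF F_extension] by blast

lemma a_if_Fa: "Suc k \<le> n \<Longrightarrow> Fa (Suc k) \<Longrightarrow> Fb k \<Longrightarrow> a (Suc k)"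
  using operator_extension.quotient_alpha[OF F_extension] fin_F_G(2) by blast

lemma Fb_down: "Suc k \<le> n \<Longrightarrow> Fb (Suc k) \<Longrightarrow> a (Suc k) \<Longrightarrow> Fb k"
  using operator_extension.sub_beta[OF F_extension] fin_F_G(2) by blast

lemma Fa_down: assumes "Suc k \<le> n" "Fa (Suc k)" shows "Fa k"
proof -
  have "{x\<in>H k. F k x = 0} \<subseteq> {x\<in>H (Suc k). F (Suc k) x = 0}"
    using F_Suc[OF assms(1)] H_Suc[OF assms(1)] by auto
  then show ?thesis
    unfolding fin_alpha_def by (rule cf.cofin_mono[OF assms(2)[unfolded fin_alpha_def] order_refl])
qed

text \<open>Extensions of Fredholm operators are Fredholm; this puts the essential spectrum of the
  matrix inside the union.\<close>

lemma fredholm_all: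
  assumes "\<And>k. k \<in> {1..n} \<Longrightarrow> a k \<and> b k" shows "Fa n" "Fb n"
proof -
  have "k \<le> n \<Longrightarrow> Fa k \<and> Fb k" for k
    by (induction k) (use F_0 Fa_Suc Fb_Suc assms in auto)
  then show "Fa n" "Fb n" by auto
qed

lemma Fa_le: assumes "Fa n" "k \<le> n" shows "Fa k"
  using assms(2,1) by (induction rule: inc_induct) (use Fa_down in auto)

lemma not_fredholm_pair:
  assumes F: "Fa n" "Fb n" and "k \<in> {1..n}" "\<not> (a k \<and> b k)"
  shows "\<exists>k\<in>{2..n}. \<not> a k \<and> (\<forall>s\<in>{1..<k}. a s) \<and> (\<exists>s\<in>{1..<k}. \<not> b s)"
proof -
  \<comment> \<open>If all kernels were finite-dimensional, \<open>Fb_down\<close> would carry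
    finite codimension from \<open>F n\<close> down to every \<open>F j\<close> and
    \<open>b_if_Fb\<close> from there to every \<open>T j\<close>, so all diagonal entries would be
    Fredholm.\<close>
  have "\<exists>k\<in>{1..n}. \<not> a k"
  proof (rule ccontr)
    assume "\<not> ?thesis"
    then have all: "\<And>k. k \<in> {1..n} \<Longrightarrow> a k" by blast
    have "Fb j" if "j \<le> n" for j
      using that by (induction rule: inc_induct) (use Fb_down all F in auto)
    then have "b j" if "j \<in> {1..n}" for j using b_if_Fb[of "j - 1"] that by auto
    then show False using assms all by blast
  qed
  then obtain m where m: "m \<in> {1..n}" "\<not> a m" by blast
  define k where "k = (LEAST k. k \<ge> 1 \<and> \<not> a k)"
  have k: "k \<ge> 1" "\<not> a k" using LeastI[of "\<lambda>k. k \<ge> 1 \<and> \<not> a k" m] m unfolding k_def by auto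
  have "k \<le> m" unfolding k_def using m by (intro Least_le) auto
  then have kn: "k \<le> n" using m by simp
  have least: "a s" if "s \<in> {1..<k}" for s
    using not_less_Least[of s "\<lambda>k. k \<ge> 1 \<and> \<not> a k"] that unfolding k_def by auto
  obtain j where j: "k = Suc j" using k(1) by (cases k) auto
  \<comment> \<open>The kernel of \<open>F k\<close> is finite-dimensional and that of
    \<open>T k\<close> is not, so the connecting map needs a cokernel of infinite dimension at
    \<open>j = k - 1\<close>. Extensions built from ranges of finite codimension could not produce
    it.\<close>
  have "\<not> Fb j" using a_if_Fa[of j] k(2) kn Fa_le[OF F(1) kn] j by blast
  have "\<exists>s\<in>{1..<k}. \<not> b s"
  proof (rule ccontr)
    assume "\<not> ?thesis"
    then have all: "\<And>s. s \<in> {1..<k} \<Longrightarrow> b s" by blast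
    have "i \<le> j \<Longrightarrow> Fb i" for i
      by (induction i) (use F_0 Fb_Suc all kn j in auto)
    then show False using \<open>\<not> Fb j\<close> by blast
  qed
  then show ?thesis using k kn least by (intro bexI[of _ k]) (auto simp: j)
qed

section \<open>Complements for the range of \<open>T 1\<close> and the kernel of
  \<open>T n\<close>\<close>

definition single :: "nat \<Rightarrow> 'a \<Rightarrow> nat \<Rightarrow> 'a" where
  "single c x = (\<lambda>i. if i = c then x else 0)"

lemma single_H: assumes "c \<in> {1..n}" "x \<in> X c" shows "single c x \<in> H n"
proof -
  have "0 \<in> X k" if "k \<in> {1..n}" for k by (rule cv.subspace_0[OF sX[OF that]])
  then show ?thesis using assms by (auto simp: single_def dsum_def)
qed

lemma single_lin: "lin_on scaleC scaleC_fun V (single c)"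
  by (auto simp: lin_on_def single_def scaleC_fun_def fun_eq_iff)

lemma nth_lin: "lin_on scaleC_fun scaleC V (\<lambda>y. y c)"
  by (simp add: lin_on_def scaleC_fun_def)

text \<open>The first column holds only the diagonal entry, so \<open>F n\<close> acts on the first
  summand as \<open>T 1\<close>.\<close>

lemma F_single_1: assumes "x \<in> X 1" shows "F n (single 1 x) = single 1 (T 1 x)"
proof
  fix i
  have 0: "(\<Sum>j\<in>{i<..n}. A i j (single 1 x j)) = 0" if "i \<ge> 1"
    using that A0[of i] by (intro sum.neutral) (auto simp: single_def)
  show "F n (single 1 x) i = single 1 (T 1 x) i"
    using 0 n T0[of i] by (auto simp: tri_matrix_def) (auto simp: single_def)
qed

lemma F_bound:
  assumes "i \<in> {1..n}"
  obtains K where "\<And>y. y \<in> H n \<Longrightarrow> norm (F n y i) \<le> K * (\<Sum>k\<in>{1..n}. norm (y k))"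
proof -
  obtain L where L: "L \<ge> 0" "\<And>x. x \<in> X i \<Longrightarrow> norm (T i x) \<le> L * norm x"
    using bounded_op_bound[OF T[OF assms]] by metis
  have "\<exists>K\<ge>0. \<forall>x\<in>X j. norm (A i j x) \<le> K * norm x" if "j \<in> {i<..n}" for j
    using bounded_op_bound[OF A, of i j] that assms by (metis atLeastAtMost_iff greaterThanAtMost_iff)
  then obtain K where K: "\<And>j. j \<in> {i<..n} \<Longrightarrow> K j \<ge> 0"
    "\<And>j x. j \<in> {i<..n} \<Longrightarrow> x \<in> X j \<Longrightarrow> norm (A i j x) \<le> K j * norm x" by metis
  have "norm (F n y i) \<le> (L + (\<Sum>j\<in>{i<..n}. K j)) * (\<Sum>k\<in>{1..n}. norm (y k))" if y: "y \<in> H n" for y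
  proof -
    let ?s = "\<Sum>k\<in>{1..n}. norm (y k)"
    have le: "norm (y k) \<le> ?s" if "k \<in> {1..n}" for k using that by (intro member_le_sum) auto
    have "norm (F n y i) \<le> norm (T i (y i)) + norm (\<Sum>j\<in>{i<..n}. A i j (y j))"
      using assms by (simp add: tri_matrix_def norm_triangle_ineq)
    also have "\<dots> \<le> L * ?s + (\<Sum>j\<in>{i<..n}. K j * ?s)"
    proof (intro add_mono sum_norm_le)
      show "norm (T i (y i)) \<le> L * ?s"
        using L(2)[OF H_nth[OF y assms]] mult_left_mono[OF le[OF assms] L(1)] by simp
      show "norm (A i j (y j)) \<le> K j * ?s" if "j \<in> {i<..n}" for j
        using K(2)[OF that H_nth[OF y, of j]] mult_left_mono[OF le[of j] K(1)[OF that]] that by auto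
    qed
    finally show ?thesis by (simp add: distrib_right sum_distrib_right)
  qed
  then show thesis using that by blast
qed

lemma F_tendsto:
  assumes y: "\<And>j. y j \<in> H n" "l \<in> H n" "\<And>k. (\<lambda>j. y j k) \<longlonglongrightarrow> l k"
  shows "(\<lambda>j. F n (y j) i) \<longlonglongrightarrow> F n l i"
proof (cases "i \<in> {1..n}")
  case True
  have "(\<lambda>j. T i (y j i)) \<longlonglongrightarrow> T i (l i)"
    using True y by (intro bounded_op_tendsto[OF T sX] H_nth) auto
  moreover have "(\<lambda>j. A i k (y j k)) \<longlonglongrightarrow> A i k (l k)" if "k \<in> {i<..n}" for k
    using that True y by (intro bounded_op_tendsto[OF A sX] H_nth) auto
  ultimately have "(\<lambda>j. T i (y j i) + (\<Sum>k\<in>{i<..n}. A i k (y j k))) \<longlonglongrightarrow> T i (l i) + (\<Sum>k\<in>{i<..n}. A i k (l k))"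
    by (intro tendsto_add tendsto_sum)
  then show ?thesis unfolding tri_matrix_def using True by simp
next
  case False
  then have "F n x i = 0" for x by (auto simp: tri_matrix_def)
  then show ?thesis by simp
qed

text \<open>Domain of both candidate complements: \<open>{1}\<close> and \<open>- {1}\<close> belong
  to the range of \<open>T 1\<close>, the empty set and \<open>- {n}\<close> to the kernel of
  \<open>T n\<close>. Conditions of this form survive coordinatewise limits, which makes the domain
  closed.\<close>

definition constrained :: "nat set \<Rightarrow> nat set \<Rightarrow> (nat \<Rightarrow> 'a) set" where
  "constrained Z Z' = {y\<in>H n. (\<forall>k\<in>Z. y k = 0) \<and> (\<forall>k\<in>Z'. F n y k = 0)}"

lemma subspace_constrained: "cf.subspace (constrained Z Z')"
proof -
  note sH = subspace_H[OF order_refl] and l = F_lin[OF order_refl]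
  have "F n 0 = 0" using cf.lin_on_zero[OF l sH cf.vector_space_axioms] .
  moreover have app: "scaleC_fun c y k = c *\<^sub>C y k" for c k and y :: "nat \<Rightarrow> 'a"
    by (simp add: scaleC_fun_def)
  ultimately show ?thesis
    unfolding cf.subspace_def constrained_def
    using cf.subspace_0[OF sH] cf.subspace_add[OF sH] cf.subspace_scale[OF sH]
    by (auto simp: lin_onD[OF l] app)
qed

lemma constrained_closed:
  assumes y: "\<And>j. y j \<in> constrained Z Z'" "\<And>k. (\<lambda>j. y j k) \<longlonglongrightarrow> l k" shows "l \<in> constrained Z Z'"
proof -
  have yH: "y j \<in> H n" for j using y(1) unfolding constrained_def by blast
  have "l k \<in> X k" if "k \<in> {1..n}" for k
    using closed_sequentially[OF cX[OF that], of "\<lambda>j. y j k"] H_nth[OF yH that] y(2) by blast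
  moreover have z: "l k = 0" if "\<And>j. y j k = 0" for k
    using y(2)[of k] that by (simp add: LIMSEQ_const_iff)
  ultimately have lH: "l \<in> H n" using yH unfolding dsum_def by auto
  have "F n l k = 0" if "k \<in> Z'" for k
  proof -
    have "F n (y j) k = 0" for j using y(1)[of j] that unfolding constrained_def by blast
    then show ?thesis using F_tendsto[OF yH lH y(2), of k] by (simp add: LIMSEQ_const_iff)
  qed
  moreover have "l k = 0" if "k \<in> Z" for k using z y(1) that unfolding constrained_def by blast
  ultimately show ?thesis using lH unfolding constrained_def by blast
qed

lemma constrained_range:
  fixes w :: "(nat \<Rightarrow> 'a) \<Rightarrow> 'a"
  assumes "lin_on scaleC_fun scaleC (H n) w"
    and "\<And>y. y \<in> H n \<Longrightarrow> norm (w y) \<le> K * (\<Sum>k\<in>{1..n}. norm (y k))"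
  shows "cv.subspace (w ` constrained Z Z')" "bounded_range TYPE(nat \<Rightarrow>\<^sub>C 'a) (w ` constrained Z Z')"
proof -
  have PH: "constrained Z Z' \<subseteq> H n" unfolding constrained_def by blast
  have w: "lin_on scaleC_fun scaleC (constrained Z Z') w" by (rule lin_on_subset[OF assms(1) PH])
  show "cv.subspace (w ` constrained Z Z')" by (rule cf.subspace_image[OF w subspace_constrained cv.vector_space_axioms])
  show "bounded_range TYPE(nat \<Rightarrow>\<^sub>C 'a) (w ` constrained Z Z')"
  proof (rule bounded_range_dsum[where n = n and X = X and K = K, OF subspace_constrained PH])
    show "l \<in> constrained Z Z'" if "\<And>j. y j \<in> constrained Z Z'" "\<And>k. (\<lambda>j. y j k) \<longlonglongrightarrow> l k" for y l
      using that by (rule constrained_closed)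
  qed (use w PH assms(2) in blast)+
qed

text \<open>Serves to bound overlaps: a vector common to the given space and its candidate
  complement turns out to be a linear image of some \<open>y\<close> in the kernel of
  \<open>F n\<close>.\<close>

lemma kernel_image_fin:
  fixes w :: "(nat \<Rightarrow> 'a) \<Rightarrow> 'a"
  assumes "Fa n" "lin_on scaleC_fun scaleC (H n) w"
  shows "cofin scaleC {} (w ` {y\<in>H n. F n y = 0})"
proof -
  have 1: "lin_on scaleC_fun scaleC {y\<in>H n. F n y = 0} w" by (rule lin_on_subset[OF assms(2)]) auto
  have 2: "cf.subspace {y\<in>H n. F n y = 0}"
    using cf.subspace_preimage[OF F_lin subspace_H cf.vector_space_axioms cf.subspace_single_0, of n] by simp
  show ?thesis
    using cf.fin_image[OF 1 2 cv.vector_space_axioms] assms(1) unfolding fin_alpha_def by blast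
qed

text \<open>Serves to bound what a sum misses: vectors that \<open>f\<close> carries into the range
  of \<open>F n\<close> can be decomposed explicitly, and they fill \<open>V\<close> up to finite
  dimension.\<close>

lemma range_preimage_cofin:
  fixes f :: "'a \<Rightarrow> nat \<Rightarrow> 'a"
  assumes "Fb n" "lin_on scaleC scaleC_fun V f" "cv.subspace V" "f ` V \<subseteq> H n"
  shows "cofin scaleC {x\<in>V. f x \<in> F n ` H n} V"
proof (rule cv.cofin_preimage[OF assms(2,3) cf.vector_space_axioms])
  show "cf.subspace (F n ` H n)"
    using cf.subspace_image[OF F_lin subspace_H cf.vector_space_axioms, of n] by simp
  show "cofin scaleC_fun (F n ` H n) (f ` V)"
    using assms(1,4) unfolding fin_beta_def by (rule cf.cofin_mono[OF _ order_refl])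
qed

lemma T_1_range_complemented:
  assumes "Fa n" "Fb n" shows "top_complemented (T 1 ` X 1) (X 1)"
proof -
  have 1: "1 \<in> {1..n}" using n by simp
  note sH = subspace_H[OF order_refl] and lF = F_lin[OF order_refl] and sX1 = sX[OF 1] and T1 = T[OF 1]
  note lT = bounded_op_lin_on[OF T1]
  define w where "w y = F n y 1" for y
  define M where "M = w ` constrained {1} (- {1})"
  have lw: "lin_on scaleC_fun scaleC (H n) w"
    using lF unfolding lin_on_def w_def by (simp add: scaleC_fun_def)
  obtain K where K: "\<And>y. y \<in> H n \<Longrightarrow> norm (w y) \<le> K * (\<Sum>k\<in>{1..n}. norm (y k))"
    using F_bound[OF 1] unfolding w_def by metis
  obtain L where L: "\<And>x. x \<in> X 1 \<Longrightarrow> norm (T 1 x) \<le> L * norm x" using bounded_op_bound[OF T1] by metis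
  show ?thesis
  proof (rule bounded_range_top_complemented[OF sX1 cX[OF 1]])
    show "cv.subspace (T 1 ` X 1)" by (rule cv.subspace_image[OF lT sX1 cv.vector_space_axioms])
    show "T 1 ` X 1 \<subseteq> X 1" using bounded_op_mem[OF T1] by blast
    show "bounded_range TYPE('a) (T 1 ` X 1)"
      using csubspace_imp_subspace[OF sX1] cX[OF 1] lin_on_real[OF lT] L by (rule bounded_rangeI)
    show "cv.subspace M" "bounded_range TYPE(nat \<Rightarrow>\<^sub>C 'a) M"
      unfolding M_def using constrained_range[OF lw K] by blast+
    show "M \<subseteq> X 1" unfolding M_def w_def constrained_def using F_mem[OF order_refl] H_nth[OF _ 1] by blast
    \<comment> \<open>If \<open>T 1 u\<close> is also the first coordinate of \<open>F n y\<close>,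
      then \<open>single 1 u - y\<close> is in the kernel of \<open>F n\<close>. Its first
      coordinate is \<open>u\<close> because \<open>y 1 = 0\<close>, so \<open>T 1\<close> recovers
      the common vector from it.\<close>
    have "T 1 ` X 1 \<inter> M \<subseteq> (\<lambda>y. T 1 (y 1)) ` {y\<in>H n. F n y = 0}"
    proof
      fix x assume "x \<in> T 1 ` X 1 \<inter> M"
      then obtain u y where u: "u \<in> X 1" "x = T 1 u" and y: "y \<in> constrained {1} (- {1})" "x = F n y 1"
        unfolding M_def w_def by blast
      have yH: "y \<in> H n" "y 1 = 0" and y0: "\<And>k. k \<noteq> 1 \<Longrightarrow> F n y k = 0" using y(1) unfolding constrained_def by auto
      have uH: "single 1 u \<in> H n" by (rule single_H[OF 1 u(1)])
      have "F n (single 1 u - y) = single 1 x - F n y"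
        using cf.lin_on_diff[OF lF sH cf.vector_space_axioms uH yH(1)] F_single_1[OF u(1)] u(2) by simp
      also have "\<dots> = 0" using y(2) y0 by (auto simp: fun_eq_iff single_def)
      finally have "single 1 u - y \<in> {y\<in>H n. F n y = 0}" using cf.subspace_diff[OF sH uH yH(1)] by blast
      moreover have "x = T 1 ((single 1 u - y) 1)" using u(2) yH(2) by (simp add: single_def)
      ultimately show "x \<in> (\<lambda>y. T 1 (y 1)) ` {y\<in>H n. F n y = 0}" by blast
    qed
    moreover have "cofin scaleC {} ((\<lambda>y. T 1 (y 1)) ` {y\<in>H n. F n y = 0})"
      using assms(1) lT H_nth[OF _ 1]
      by (intro kernel_image_fin) (auto simp: lin_on_def scaleC_fun_def)
    ultimately show "cofin scaleC {} (T 1 ` X 1 \<inter> M)" by (rule cv.cofin_mono[OF _ order_refl, rotated])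
    let ?V = "{x\<in>X 1. single 1 x \<in> F n ` H n}"
    \<comment> \<open>If \<open>single 1 x = F n h\<close>, removing the first coordinate from
      \<open>h\<close> splits \<open>x\<close> into \<open>T 1 (h 1)\<close> and a vector of
      \<open>M\<close>.\<close>
    have "?V \<subseteq> cv.span (T 1 ` X 1 \<union> M)"
    proof clarify
      fix x h assume x: "x \<in> X 1" and h: "h \<in> H n" "single 1 x = F n h"
      have h1: "h 1 \<in> X 1" by (rule H_nth[OF h(1) 1])
      have hH: "single 1 (h 1) \<in> H n" by (rule single_H[OF 1 h1])
      let ?y = "h - single 1 (h 1)"
      have Fy: "F n ?y = single 1 x - single 1 (T 1 (h 1))"
        using cf.lin_on_diff[OF lF sH cf.vector_space_axioms h(1) hH] F_single_1[OF h1] h(2) by simp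
      then have "?y \<in> constrained {1} (- {1})"
        using cf.subspace_diff[OF sH h(1) hH] unfolding constrained_def by (simp add: single_def)
      moreover have "w ?y = x - T 1 (h 1)" unfolding w_def Fy by (simp add: single_def)
      ultimately have "x - T 1 (h 1) \<in> M" unfolding M_def by (metis imageI)
      then have "T 1 (h 1) + (x - T 1 (h 1)) \<in> cv.span (T 1 ` X 1 \<union> M)"
        using h1 by (intro cv.span_add) (auto intro: cv.span_base)
      then show "x \<in> cv.span (T 1 ` X 1 \<union> M)" by simp
    qed
    then have "cofin scaleC (T 1 ` X 1 \<union> M) ?V" by (rule cv.cofin_span_superset)
    moreover have "cofin scaleC ?V (X 1)"
      using single_H[OF 1] by (intro range_preimage_cofin assms single_lin sX1) auto
    ultimately show "cofin scaleC (T 1 ` X 1 \<union> M) (X 1)" by (rule cv.cofin_trans)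
  qed
qed

lemma T_n_kernel_complemented:
  assumes "Fa n" "Fb n" shows "top_complemented {x\<in>X n. T n x = 0} (X n)"
proof -
  have nn: "n \<in> {1..n}" using n by simp
  note sXn = sX[OF nn] and Tn = T[OF nn]
  note lT = bounded_op_lin_on[OF Tn]
  have Fn: "F n y n = T n (y n)" for y using n by (simp add: tri_matrix_def)
  define R where "R = {x\<in>X n. T n x = 0}"
  define M where "M = (\<lambda>y. y n) ` constrained {} (- {n})"
  have lw: "lin_on scaleC_fun scaleC (H n) (\<lambda>y. y n)" by (rule nth_lin)
  have K: "norm (y n) \<le> 1 * (\<Sum>k\<in>{1..n}. norm (y k))" for y :: "nat \<Rightarrow> 'a"
    using member_le_sum[of n "{1..n}" "\<lambda>k. norm (y k)"] nn by simp
  obtain L where L: "\<And>x. x \<in> X n \<Longrightarrow> norm (T n x) \<le> L * norm x" using bounded_op_bound[OF Tn] by metis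
  have sR: "cv.subspace R"
    unfolding R_def using cv.subspace_preimage[OF lT sXn cv.vector_space_axioms cv.subspace_single_0] by simp
  have cR: "closed R"
    using closed_preimage_lin_on[OF csubspace_imp_subspace[OF sXn] cX[OF nn] closed_singleton lin_on_real[OF lT] L, of 0]
    unfolding R_def by simp
  have "top_complemented R (X n)"
  proof (rule bounded_range_top_complemented[OF sXn cX[OF nn] sR])
    show "R \<subseteq> X n" unfolding R_def by blast
    \<comment> \<open>Being closed, the kernel is the range of the identity on itself.\<close>
    have "bounded_range TYPE('a) ((\<lambda>x. x) ` R)"
      using csubspace_imp_subspace[OF sR] cR lin_on_id by (rule bounded_rangeI[where K = 1]) simp
    then show "bounded_range TYPE('a) R" by simp
    show "cv.subspace M" "bounded_range TYPE(nat \<Rightarrow>\<^sub>C 'a) M"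
      unfolding M_def using constrained_range[OF lw K] by blast+
    show "M \<subseteq> X n" unfolding M_def constrained_def using H_nth[OF _ nn] by blast
    \<comment> \<open>The only coordinate of \<open>F n y\<close> left free is
      \<open>T n (y n)\<close>, and it vanishes when \<open>y n\<close> lies in \<open>R\<close>;
      then \<open>y\<close> is in the kernel of \<open>F n\<close>.\<close>
    have "R \<inter> M \<subseteq> (\<lambda>y. y n) ` {y\<in>H n. F n y = 0}"
    proof
      fix x assume "x \<in> R \<inter> M"
      then obtain y where y: "y \<in> H n" "\<And>k. k \<noteq> n \<Longrightarrow> F n y k = 0" "x = y n" "T n (y n) = 0"
        unfolding R_def M_def constrained_def by auto
      have "F n y k = 0" for k using y(2,4) Fn by (cases "k = n") auto
      then show "x \<in> (\<lambda>y. y n) ` {y\<in>H n. F n y = 0}" using y(1,3) by (auto simp: fun_eq_iff)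
    qed
    then show "cofin scaleC {} (R \<inter> M)"
      by (rule cv.cofin_mono[OF kernel_image_fin[OF assms(1) lw] order_refl])
    let ?V = "{x\<in>X n. single n (T n x) \<in> F n ` H n}"
    \<comment> \<open>A vector \<open>h\<close> with \<open>F n h = single n (T n x)\<close>
      satisfies \<open>T n (h n) = T n x\<close>, so \<open>x\<close> is \<open>h n\<close> up to
      the kernel of \<open>T n\<close>.\<close>
    have "?V \<subseteq> cv.span (R \<union> M)"
    proof clarify
      fix x h assume x: "x \<in> X n" and h: "h \<in> H n" "single n (T n x) = F n h"
      have hn: "h n \<in> X n" by (rule H_nth[OF h(1) nn])
      have "T n (h n) = T n x" using Fn[of h] unfolding h(2)[symmetric] by (simp add: single_def)
      then have "x - h n \<in> R"
        unfolding R_def using cv.subspace_diff[OF sXn x hn] cv.lin_on_diff[OF lT sXn cv.vector_space_axioms x hn] by simp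
      moreover have "F n h k = 0" if "k \<noteq> n" for k
        unfolding h(2)[symmetric] using that by (simp add: single_def)
      then have "h \<in> constrained {} (- {n})" unfolding constrained_def using h(1) by simp
      then have "h n \<in> M" unfolding M_def by blast
      ultimately have "(x - h n) + h n \<in> cv.span (R \<union> M)"
        by (intro cv.span_add) (auto intro: cv.span_base)
      then show "x \<in> cv.span (R \<union> M)" by simp
    qed
    then have "cofin scaleC (R \<union> M) ?V" by (rule cv.cofin_span_superset)
    moreover have "cofin scaleC ?V (X n)"
    proof (intro range_preimage_cofin assms sXn)
      show "lin_on scaleC scaleC_fun (X n) (\<lambda>x. single n (T n x))"
        using lT by (auto simp: lin_on_def single_def scaleC_fun_def fun_eq_iff)
      show "(\<lambda>x. single n (T n x)) ` X n \<subseteq> H n" using single_H[OF nn] bounded_op_mem[OF Tn] by blast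
    qed
    ultimately show "cofin scaleC (R \<union> M) (X n)" by (rule cv.cofin_trans)
  qed
  then show ?thesis unfolding R_def .
qed

lemma alpha_finite_iff: "k \<in> {1..n} \<Longrightarrow> alpha (X k) (T k) < \<infinity> \<longleftrightarrow> a k"
  by (rule galpha_finite_iff[OF cv.vector_space_axioms sX bounded_op_lin_on[OF T]])

lemma beta_finite_iff: "k \<in> {1..n} \<Longrightarrow> beta (X k) (T k) < \<infinity> \<longleftrightarrow> b k"
  using gbeta_finite_iff[OF cv.vector_space_axioms sX bounded_op_lin_on[OF T]] bounded_op_mem[OF T] by blast

lemma left_fredholm_1: assumes "Fa n" "Fb n" shows "left_fredholm (X 1) (T 1)"
proof -
  \<comment> \<open>\<open>T 1\<close> is the quotient in the extension of the zero space, where the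
    range trivially has finite codimension.\<close>
  have "a 1" using a_if_Fa[of 0] n F_0 Fa_le[OF assms(1), of 1] by simp
  then show ?thesis
    using T_1_range_complemented[OF assms] alpha_finite_iff[of 1] n
    unfolding left_fredholm_def top_complemented_def by auto
qed

lemma right_fredholm_n: assumes "Fa n" "Fb n" shows "right_fredholm (X n) (T n)"
proof -
  have "b n" using b_if_Fb[of "n - 1"] n assms(2) by simp
  then show ?thesis
    using T_n_kernel_complemented[OF assms] beta_finite_iff[of n] n unfolding right_fredholm_def by auto
qed

text \<open>The shifted matrix in \<open>ess_spec_sum\<close> and \<open>F n\<close> are compared on
  \<open>H n\<close> only: elsewhere coordinates of \<open>x\<close> outside \<open>{1..n}\<close>
  survive the subtraction. \<open>galpha\<close> and \<open>gbeta\<close> look at values on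
  \<open>H n\<close> alone.\<close>

lemma ess_spec_sum_cong:
  assumes "\<And>x. x \<in> H n \<Longrightarrow> G x = F n x"
  shows "galpha scaleC_fun (H n) G < \<infinity> \<longleftrightarrow> Fa n" "gbeta scaleC_fun (H n) (H n) G < \<infinity> \<longleftrightarrow> Fb n"
proof -
  note sH = subspace_H[OF order_refl] and lF = F_lin[OF order_refl]
  have "{x\<in>H n. G x = 0} = {x\<in>H n. F n x = 0}" "G ` H n = F n ` H n" using assms by auto
  then have "galpha scaleC_fun (H n) G = galpha scaleC_fun (H n) (F n)"
    "gbeta scaleC_fun (H n) (H n) G = gbeta scaleC_fun (H n) (H n) (F n)"
    unfolding galpha_def gbeta_def by simp_all
  then show "galpha scaleC_fun (H n) G < \<infinity> \<longleftrightarrow> Fa n" "gbeta scaleC_fun (H n) (H n) G < \<infinity> \<longleftrightarrow> Fb n"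
    using galpha_finite_iff[OF cf.vector_space_axioms sH lF]
      gbeta_finite_iff[OF cf.vector_space_axioms sH lF] F_mem[OF order_refl] by auto
qed

end

lemma shift_bounded_op:
  assumes X: "banach_subspace X" and T: "bounded_op X X T"
  shows "bounded_op X X (shift T z)"
proof -
  have sX: "cv.subspace X" using X by (simp add: banach_subspace_def csubspace_iff)
  obtain K where K: "\<And>x. x \<in> X \<Longrightarrow> norm (T x) \<le> K * norm x" using bounded_op_bound[OF T] by metis
  have "norm (shift T z x) \<le> (K + cmod z) * norm x" if "x \<in> X" for x
    using norm_triangle_ineq4[of "T x" "z *\<^sub>C x"] K[OF that]
    by (simp add: shift_def norm_scaleC distrib_right)
  moreover have "shift T z x \<in> X" if "x \<in> X" for x
    unfolding shift_def using that sX bounded_op_mem[OF T]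
    by (intro cv.subspace_diff cv.subspace_scale) auto
  moreover have "shift T z (x + y) = shift T z x + shift T z y" if "x \<in> X" "y \<in> X" for x y
    using lin_onD(1)[OF bounded_op_lin_on[OF T] that] by (simp add: shift_def scaleC_add_right)
  moreover have "shift T z (c *\<^sub>C x) = c *\<^sub>C shift T z x" if "x \<in> X" for x c
    using lin_onD(2)[OF bounded_op_lin_on[OF T] that, of c]
    by (simp add: shift_def cv.scale_right_diff_distrib scaleC_scaleC mult.commute)
  ultimately show ?thesis unfolding bounded_op_def by blast
qed

lemma tri_matrix_shift:
  assumes "x \<in> dsum n X"
  shows "tri_matrix n D A x - scaleC_fun z x = tri_matrix n (\<lambda>k. shift (D k) z) A x"
proof
  fix i
  show "(tri_matrix n D A x - scaleC_fun z x) i = tri_matrix n (\<lambda>k. shift (D k) z) A x i"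
    using assms by (cases "i \<in> {1..n}") (auto simp: tri_matrix_def scaleC_fun_def shift_def dsum_def)
qed

theorem mainTheorem10:
  fixes n :: nat
    and X :: "nat \<Rightarrow> 'a::complex_banach set"
    and D :: "nat \<Rightarrow> 'a \<Rightarrow> 'a"
    and A :: "nat \<Rightarrow> nat \<Rightarrow> 'a \<Rightarrow> 'a"
  assumes "n \<ge> 2"
    and "\<forall>k\<in>{1..n}. banach_subspace (X k)"
    and "\<forall>k\<in>{1..n}. bounded_op (X k) (X k) (D k)"
    and "\<forall>s\<in>{2..n-1}. \<forall>z. complements_condition (X s) (shift (D s) z)"
    and "\<forall>i j. 1 \<le> i \<and> i < j \<and> j \<le> n \<longrightarrow> bounded_op (X j) (X i) (A i j)"
  shows "(\<Union>k\<in>{1..n}. ess_spec (X k) (D k)) =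
     ess_spec_sum n X (tri_matrix n D A) \<union>
     ((({z. \<exists>k\<in>{2..n-1}.
            (alpha (X k) (shift (D k) z) = \<infinity> \<and>
             (\<Sum>s\<in>{1..k-1}. beta (X s) (shift (D s) z)) = \<infinity> \<and>
             (\<forall>s\<in>{2..k-1}. alpha (X s) (shift (D s) z) < \<infinity>))
          \<or> (beta (X k) (shift (D k) z) = \<infinity> \<and>
             (\<Sum>s\<in>{k+1..n}. alpha (X s) (shift (D s) z)) = \<infinity> \<and>
             (\<forall>s\<in>{k+1..n-1}. beta (X s) (shift (D s) z) < \<infinity>))}
        \<union>
        {z. (alpha (X n) (shift (D n) z) = \<infinity> \<and>
             (\<Sum>s\<in>{1..n-1}. beta (X s) (shift (D s) z)) = \<infinity> \<and>
             (\<forall>s\<in>{2..n-1}. alpha (X s) (shift (D s) z) < \<infinity>))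
          \<or> (beta (X 1) (shift (D 1) z) = \<infinity> \<and>
             (\<Sum>s\<in>{2..n}. alpha (X s) (shift (D s) z)) = \<infinity> \<and>
             (\<forall>s\<in>{2..n-1}. beta (X s) (shift (D s) z) < \<infinity>))})
       \<inter> rho_le (X 1) (D 1)) \<inter> rho_re (X n) (D n))"
  (is "?L = ?E \<union> (((?\<Delta>1 \<union> ?\<Delta>2) \<inter> ?l) \<inter> ?r)")
proof (rule set_eqI)
  fix z
  define T where "T k = shift (D k) z" for k
  interpret triangular_operator n X T A
  proof unfold_locales
    show "1 \<le> n" using assms(1) by simp
    show "banach_subspace (X k)" if "k \<in> {1..n}" for k using assms(2) that by blast
    show "bounded_op (X k) (X k) (T k)" if "k \<in> {1..n}" for k
      unfolding T_def using assms(2,3) that by (intro shift_bounded_op) auto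
    show "bounded_op (X j) (X i) (A i j)" if "1 \<le> i" "i < j" "j \<le> n" for i j
      using assms(5) that by blast
  qed
  have shift: "tri_matrix n D A x - scaleC_fun z x = F n x" if "x \<in> H n" for x
    unfolding T_def using that by (rule tri_matrix_shift)
  have E: "z \<in> ?E \<longleftrightarrow> \<not> (Fa n \<and> Fb n)"
    using ess_spec_sum_cong[of "\<lambda>x. tri_matrix n D A x - scaleC_fun z x", OF shift]
    unfolding ess_spec_sum_def by blast
  have "z \<in> ess_spec (X k) (D k) \<longleftrightarrow> \<not> (a k \<and> b k)" if "k \<in> {1..n}" for k
    using alpha_finite_iff[OF that] beta_finite_iff[OF that]
    unfolding ess_spec_def fredholm_def T_def mem_Collect_eq by blast
  then have L: "z \<in> ?L \<longleftrightarrow> (\<exists>k\<in>{1..n}. \<not> (a k \<and> b k))" by blast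
  have inf: "alpha (X k) (T k) = \<infinity> \<longleftrightarrow> \<not> a k" "beta (X k) (T k) = \<infinity> \<longleftrightarrow> \<not> b k" if "k \<in> {1..n}" for k
    using alpha_finite_iff[OF that] beta_finite_iff[OF that] by auto
  define \<Delta> where "\<Delta> = ((?\<Delta>1 \<union> ?\<Delta>2) \<inter> ?l) \<inter> ?r"
  \<comment> \<open>Each of the four cases contains an infinite \<open>alpha\<close> or
    \<open>beta\<close> of a single diagonal entry, which by itself keeps that entry from being
    Fredholm.\<close>
  have \<Delta>1: "\<exists>k\<in>{1..n}. \<not> (a k \<and> b k)" if "z \<in> \<Delta>"
  proof -
    have "\<exists>k\<in>{1..n}. alpha (X k) (T k) = \<infinity> \<or> beta (X k) (T k) = \<infinity>"
    proof -
      have "{2..n-1} \<subseteq> {1..n}" "n \<in> {1..n}" "1 \<in> {1..n}" using assms(1) by auto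
      then show ?thesis using that unfolding \<Delta>_def T_def Int_iff Un_iff mem_Collect_eq by blast
    qed
    then show ?thesis using inf by blast
  qed
  have \<Delta>2: "z \<in> \<Delta>" if F: "Fa n" "Fb n" and k: "k \<in> {1..n}" "\<not> (a k \<and> b k)" for k
  proof -
    obtain m s where m: "m \<in> {2..n}" "\<not> a m" "\<forall>s\<in>{1..<m}. a s" and s: "s \<in> {1..<m}" "\<not> b s"
      using not_fredholm_pair[OF F k] by blast
    have "alpha (X m) (T m) = \<infinity>" using inf(1)[of m] m by auto
    moreover have "(\<Sum>s\<in>{1..m-1}. beta (X s) (T s)) = \<infinity>"
      using s inf(2)[of s] m(1) by (intro sum_enat_infinity[of _ s]) auto
    moreover have "\<forall>s\<in>{2..m-1}. alpha (X s) (T s) < \<infinity>"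
      using m(1,3) alpha_finite_iff by auto
    ultimately have m\<Delta>: "alpha (X m) (shift (D m) z) = \<infinity> \<and>
        (\<Sum>s\<in>{1..m-1}. beta (X s) (shift (D s) z)) = \<infinity> \<and>
        (\<forall>s\<in>{2..m-1}. alpha (X s) (shift (D s) z) < \<infinity>)"
      unfolding T_def by blast
    \<comment> \<open>A first infinite-dimensional kernel at \<open>m = n\<close> is case (c); an
      earlier one is case (a) with \<open>k = m\<close>, where \<open>m\<close> is at least 2
      because some \<open>s\<close> precedes it.\<close>
    have "z \<in> ?\<Delta>1 \<union> ?\<Delta>2"
    proof (cases "m = n")
      case True
      then show ?thesis using m\<Delta> by blast
    next
      case False
      then have "m \<in> {2..n-1}" using m(1) by auto
      then show ?thesis using m\<Delta> by blast
    qed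
    then show ?thesis
      using left_fredholm_1[OF F] right_fredholm_n[OF F] unfolding \<Delta>_def rho_le_def rho_re_def T_def by blast
  qed
  show "z \<in> ?L \<longleftrightarrow> z \<in> ?E \<union> (((?\<Delta>1 \<union> ?\<Delta>2) \<inter> ?l) \<inter> ?r)"
    unfolding \<Delta>_def[symmetric] L Un_iff[of z ?E] E using \<Delta>1 \<Delta>2 fredholm_all by blast
qed

end
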